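(* Let $X_1,X_2,\ldots$ be iid random variables with cdf $F$, let $F_n$ be the empirical cdf of $X_1,\dots,X_n$, and let $p\in(0,1)$. Let $$\mathrm{TVaR}(p)=\frac{1}{1-p}\int_p^1 F^{-1}(u)\,du,\qquad \mathrm{TVaR}_n(p)=\frac{1}{1-p}\int_p^1 F_n^{-1}(u)\,du .$$ (1) If $F\in\mathcal{F}^{+}_{1}$, then $\mathrm{TVaR}_n(p)\stackrel{\mathbb{P}}{\to}\mathrm{TVaR}(p)$ as $n\to\infty$. (2) If $F\in\mathcal{F}^{+}_{2}$ and the quantile function $F^{-1}$ is continuous at the point $p$, then $$\sqrt{n}\,\big(\mathrm{TVaR}_n(p)-\mathrm{TVaR}(p)\big)\stackrel{d}{\to}\mathcal{N}(0,\sigma^2(p)),$$ where $$\sigma^2(p)=\frac{1}{(1-p)^2}\int^{\infty }_{F^{-1}(p)} \int^{\infty }_{F^{-1}(p)} \big( F(x \wedge y) -F(x)F(y) \big)\, dx\, dy .$$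
   Context: The quantile function of a cdf $F$ is $F^{-1}(u)=\inf\{x\in\mathbb{R}: F(x)\ge u\}$ for $u\in(0,1]$ and $F^{-1}(0)=\lim_{u\downarrow 0}F^{-1}(u)$. The empirical cdf is $F_n(x)=\frac1n\sum_{i=1}^n\mathbf{1}\{X_i\le x\}$, with quantile function $F_n^{-1}$ defined in the same way. For $k\in\{1,2\}$, $\mathcal{F}^{+}_{k}$ is the class of cdf's $F$ with $\mathbb{E}((X^{+})^k)<\infty$ for $X\sim F$, where $X^{+}=X\vee 0$ (equivalently, $\int_p^1 (F^{-1}(u))^k\,du$ is finite). $x\wedge y=\min\{x,y\}$; $\stackrel{\mathbb{P}}{\to}$ and $\stackrel{d}{\to}$ denote convergence in probability and in distribution; $\mathcal{N}(0,\sigma^2)$ is the normal distribution (degenerate at $0$ if $\sigma^2=0$). *)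

theory Defs
  imports "HOL-Probability.Probability"
begin

text \<open>
  Quantile functions take values in the extended reals, because the value at 0 may be minus
  infinity and the value at 1 may be plus infinity. Only arguments in [0,1] are meaningful.
\<close>

definition quantile :: "(real \<Rightarrow> real) \<Rightarrow> real \<Rightarrow> ereal" where
  "quantile F u =
     (if 0 < u then (INF x\<in>{x. u \<le> F x}. ereal x)
      else Lim (at_right 0) (\<lambda>v. INF x\<in>{x. v \<le> F x}. ereal x))"

definition empirical_cdf :: "(nat \<Rightarrow> 'a \<Rightarrow> real) \<Rightarrow> nat \<Rightarrow> 'a \<Rightarrow> real \<Rightarrow> real" where
  "empirical_cdf X n \<omega> x = (1 / real n) * (\<Sum>i=1..n. indicator {\<omega>'. X i \<omega>' \<le> x} \<omega>)"

text \<open>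
  For 0 < p < 1 the quantile is finite on the open interval from p to 1, so the conversion to
  the reals does not change the integrand.
\<close>

definition TVaR :: "(real \<Rightarrow> real) \<Rightarrow> real \<Rightarrow> real" where
  "TVaR F p = (1 / (1 - p)) * (LBINT u=ereal p..1. real_of_ereal (quantile F u))"

definition cdfs_plus :: "nat \<Rightarrow> (real \<Rightarrow> real) set" where
  "cdfs_plus k =
     {cdf \<mu> | \<mu>. real_distribution \<mu> \<and> integrable \<mu> (\<lambda>x. (max x 0) ^ k)}"

definition conv_in_prob :: "'a measure \<Rightarrow> (nat \<Rightarrow> 'a \<Rightarrow> real) \<Rightarrow> ('a \<Rightarrow> real) \<Rightarrow> bool" where
  "conv_in_prob M Y Z \<longleftrightarrow>
     (\<forall>n. Y n \<in> borel_measurable M) \<and> Z \<in> borel_measurable M \<and>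
     (\<forall>\<epsilon>>0. (\<lambda>n. measure M {\<omega> \<in> space M. \<bar>Y n \<omega> - Z \<omega>\<bar> > \<epsilon>}) \<longlonglongrightarrow> 0)"

definition conv_in_distr :: "'a measure \<Rightarrow> (nat \<Rightarrow> 'a \<Rightarrow> real) \<Rightarrow> real measure \<Rightarrow> bool" where
  "conv_in_distr M Y \<mu> \<longleftrightarrow>
     (\<forall>n. Y n \<in> borel_measurable M) \<and> weak_conv_m (\<lambda>n. distr M borel (Y n)) \<mu>"

text \<open>The second parameter is the variance; \<^const>\<open>normal_density\<close> takes the standard deviation.\<close>

definition normal_distr :: "real \<Rightarrow> real \<Rightarrow> real measure" where
  "normal_distr m v =
     (if v = 0 then return borel m else density lborel (\<lambda>x. ennreal (normal_density m (sqrt v) x)))"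

definition TVaR_variance :: "(real \<Rightarrow> real) \<Rightarrow> real \<Rightarrow> real" where
  "TVaR_variance F p = (1 / (1 - p)\<^sup>2) *
     (LBINT y=quantile F p..\<infinity>. (LBINT x=quantile F p..\<infinity>. F (min x y) - F x * F y))"

end

theory Submission
  imports Defs "HOL-Real_Asymp.Real_Asymp"
begin

text \<open>
  Let \<open>a = F\<^sup>-\<^sup>1(p)\<close> and \<open>c = F\<^sub>n\<^sup>-\<^sup>1(p)\<close>. The quantile transform gives
  \<open>(1 - p) TVaR\<^sub>n(p) = \<phi>(c)\<close>, where \<open>\<phi>(d) = (1 - p) d + (1/n) \<Sum> (X\<^sub>i - d)\<^sup>+\<close>. Replacing the
  random \<open>c\<close> by the constant \<open>a\<close> leaves an average of the iid variables \<open>(X\<^sub>i - a)\<^sup>+\<close>, to which the weak law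
  and the central limit theorem apply. The error \<open>\<phi>(a) - \<phi>(c)\<close> is the integral of \<open>F\<^sub>n - p\<close> from
  \<open>c\<close> to \<open>a\<close>, and on that interval \<open>p\<close> lies between \<open>F\<close> and \<open>F\<^sub>n\<close>. Hence, as long as
  \<open>\<bar>c - a\<bar> \<le> K\<close>, the error is at most the integral of \<open>\<bar>F\<^sub>n - F\<bar>\<close> over \<open>[a - K, a + K]\<close>,
  whose expectation is at most \<open>2 K / \<surd>n\<close>. For the weak law any large \<open>K\<close> will do; for the
  central limit theorem continuity of the quantile function at \<open>p\<close> allows \<open>K\<close> to be arbitrarily small. The
  limit variance is that of \<open>(X - a)\<^sup>+\<close>, rewritten by Fubini's theorem.
\<close>

section \<open>Quantile functions and TVaR\<close>

text \<open>By \<open>pseudoinverse\<close> the superlevel set at \<open>u\<close> is the closed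
  half-line starting at \<open>I u\<close>, so the infimum is attained. This links the extended-real
  \<open>quantile\<close> to the real generalised inverse \<open>I\<close>; \<open>a = 0\<close>
  puts \<open>u\<close> in the first clause of \<open>quantile\<close>.\<close>

lemma (in right_continuous_mono) quantile_eq_I:
  assumes "a = 0" "0 < u" "u < b"
  shows "quantile f u = ereal (I u)"
proof -
  have "x \<in> {x. u \<le> f x} \<longleftrightarrow> x \<in> {I u..}" for x
    unfolding mem_Collect_eq atLeast_iff using assms(2,3) by (intro pseudoinverse) (simp_all add: assms(1))
  then have "{x. u \<le> f x} = {I u..}"
    by (rule set_eqI)
  then have "(INF x\<in>{x. u \<le> f x}. ereal x) = (INF x\<in>{I u..}. ereal x)"
    by (rule arg_cong)
  also have "\<dots> = ereal (I u)"
    by (rule INF_eqI) auto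
  finally have "(INF x\<in>{x. u \<le> f x}. ereal x) = ereal (I u)" .
  then show ?thesis
    using assms by (simp add: quantile_def)
qed

text \<open>Quantile transform: \<open>I\<close> carries the uniform law on (0,1) to
  \<open>M\<close>, so an integral of the quantile becomes an expectation under \<open>M\<close>.
  The result is the Rockafellar-Uryasev form of TVaR, evaluated at its minimiser
  \<open>I p\<close>.\<close>

lemma (in cdf_distribution) TVaR_cdf_eq:
  assumes p: "0 < p" "p < 1" and int: "integrable M (\<lambda>x. max (x - I p) 0)"
  shows "TVaR C p = I p + (\<integral>x. max (x - I p) 0 \<partial>M) / (1 - p)"
proof -
  let ?N = "restrict_space lborel {0<..<1::real}"
  have [measurable]: "I \<in> borel_measurable ?N"
    using measurable_CI by (simp add: measurable_def space_restrict_space sets_restrict_space)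
  have iN: "integrable ?N (\<lambda>u. max (I u - I p) 0)"
    using int integrable_distr_eq[of I ?N borel "\<lambda>x. max (x - I p) 0"]
    by (simp add: distr_I_eq_M)
  have eN: "(\<integral>x. max (x - I p) 0 \<partial>M) = (\<integral>u. max (I u - I p) 0 \<partial>?N)"
    using integral_distr[of I ?N borel "\<lambda>x. max (x - I p) 0"] by (simp add: distr_I_eq_M)
  have i1: "integrable lborel (\<lambda>u. indicator {0<..<1} u *\<^sub>R max (I u - I p) 0)"
    using iN by (subst (asm) integrable_restrict_space) auto
  have e1: "(\<integral>x. max (x - I p) 0 \<partial>M) = (\<integral>u. indicator {0<..<1} u *\<^sub>R max (I u - I p) 0 \<partial>lborel)"
    unfolding eN by (subst integral_restrict_space) auto
  \<comment> \<open>Since \<open>I\<close> is monotone, the positive part of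
    \<open>I u - I p\<close> vanishes for \<open>u \<le> p\<close>. This extends the integral from
    (p,1) to the whole unit interval, where the transform applies.\<close>
  have split: "indicator {p<..<1} u *\<^sub>R real_of_ereal (quantile C u) =
      indicator {0<..<1} u *\<^sub>R max (I u - I p) 0 + indicator {p<..<1} u *\<^sub>R I p" for u
  proof (cases "0 < u \<and> u < 1")
    case True
    moreover have "I u \<le> I p" if "u \<le> p"
      using mono_onD[OF mono_I, of u p] that True p by auto
    moreover have "I p \<le> I u" if "p \<le> u"
      using mono_onD[OF mono_I, of p u] that True p by auto
    ultimately show ?thesis
      using quantile_eq_I[of u] by (auto simp: indicator_def max_def)
  qed (use p in \<open>auto simp: indicator_def\<close>)
  have "(LBINT u=ereal p..1. real_of_ereal (quantile C u)) =
      (\<integral>u. indicator {p<..<1} u *\<^sub>R real_of_ereal (quantile C u) \<partial>lborel)"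
    using p by (simp add: interval_lebesgue_integral_def set_lebesgue_integral_def
      one_ereal_def)
  also have "\<dots> = (\<integral>x. max (x - I p) 0 \<partial>M) + (1 - p) * I p"
    unfolding split e1 using p i1 by (subst Bochner_Integration.integral_add) auto
  finally show ?thesis
    using p by (simp add: TVaR_def field_simps)
qed

lemma (in cdf_distribution) integrable_positive_part_shift:
  fixes c d :: real
  assumes "integrable M (\<lambda>x. max (x - c) 0)"
  shows "integrable M (\<lambda>x. max (x - d) 0)"
proof (rule Bochner_Integration.integrable_bound)
  show "integrable M (\<lambda>x. max (x - c) 0 + \<bar>c - d\<bar>)"
    using assms by simp
qed auto

section \<open>Limit theorems for sample means\<close>

text \<open>Adding one summand creates a cross term \<open>Z i * ?S\<close> of expectation 0,
  because \<open>Z i\<close> is centred and independent of the remaining sum. Integrability is part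
  of the conclusion so that the induction carries it along.\<close>

lemma (in prob_space) sum_indep_square:
  fixes Z :: "'i \<Rightarrow> 'a \<Rightarrow> real"
  assumes "finite I" "indep_vars (\<lambda>_. borel) Z I"
    and "\<And>i. i \<in> I \<Longrightarrow> integrable M (\<lambda>\<omega>. (Z i \<omega>)\<^sup>2)"
    and "\<And>i. i \<in> I \<Longrightarrow> expectation (Z i) = 0"
  shows "integrable M (\<lambda>\<omega>. (\<Sum>i\<in>I. Z i \<omega>)\<^sup>2) \<and>
    expectation (\<lambda>\<omega>. (\<Sum>i\<in>I. Z i \<omega>)\<^sup>2) = (\<Sum>i\<in>I. expectation (\<lambda>\<omega>. (Z i \<omega>)\<^sup>2))"
  using assms
proof (induction I rule: finite_induct)
  case (insert i I)
  let ?S = "\<lambda>\<omega>. \<Sum>i\<in>I. Z i \<omega>"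
  have [measurable]: "j \<in> insert i I \<Longrightarrow> Z j \<in> borel_measurable M" for j
    using insert.prems(1) by (auto simp: indep_vars_def2)
  have IH: "integrable M (\<lambda>\<omega>. (?S \<omega>)\<^sup>2)"
    "expectation (\<lambda>\<omega>. (?S \<omega>)\<^sup>2) = (\<Sum>i\<in>I. expectation (\<lambda>\<omega>. (Z i \<omega>)\<^sup>2))"
    using insert.IH insert.prems indep_vars_subset[OF insert.prems(1), of I] by auto
  have iZ: "integrable M (Z i)"
    by (rule square_integrable_imp_integrable) (use insert.prems in auto)
  have iS: "integrable M ?S"
    by (rule square_integrable_imp_integrable[OF _ IH(1)]) auto
  have ind: "indep_var borel (Z i) borel ?S"
    by (rule indep_vars_sum) (use insert in auto)
  have iZS: "integrable M (\<lambda>\<omega>. Z i \<omega> * ?S \<omega>)"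
    by (rule indep_var_integrable[OF ind iZ iS])
  have eZS: "expectation (\<lambda>\<omega>. Z i \<omega> * ?S \<omega>) = 0"
    using indep_var_lebesgue_integral[OF ind iZ iS] insert.prems by simp
  have "(\<lambda>\<omega>. (\<Sum>j\<in>insert i I. Z j \<omega>)\<^sup>2) = (\<lambda>\<omega>. (Z i \<omega>)\<^sup>2 + 2 * (Z i \<omega> * ?S \<omega>) + (?S \<omega>)\<^sup>2)"
    using insert by (auto simp: power2_sum)
  then show ?case
    using insert iZS eZS IH by (simp add: integral_mult_right)
qed simp

text \<open>Nonnegativity of the variance of \<open>\<bar>W\<bar>\<close>.\<close>

lemma (in prob_space) expectation_abs_le_sqrt:
  fixes W :: "'a \<Rightarrow> real"
  assumes [measurable]: "W \<in> borel_measurable M" and i2: "integrable M (\<lambda>\<omega>. (W \<omega>)\<^sup>2)"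
  shows "expectation (\<lambda>\<omega>. \<bar>W \<omega>\<bar>) \<le> sqrt (expectation (\<lambda>\<omega>. (W \<omega>)\<^sup>2))"
proof -
  have i1: "integrable M (\<lambda>\<omega>. \<bar>W \<omega>\<bar>)"
    by (rule square_integrable_imp_integrable) (use i2 in auto)
  have "0 \<le> variance (\<lambda>\<omega>. \<bar>W \<omega>\<bar>)"
    by (rule variance_positive)
  then have "(expectation (\<lambda>\<omega>. \<bar>W \<omega>\<bar>))\<^sup>2 \<le> expectation (\<lambda>\<omega>. (W \<omega>)\<^sup>2)"
    using variance_eq[OF i1] i2 by simp
  then show ?thesis
    by (rule real_le_rsqrt)
qed

text \<open>Indices start at 1, as in \<open>empirical_cdf\<close>; nothing is known about
  \<open>X 0\<close>, hence the premises \<open>1 \<le> i\<close> below.\<close>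

locale iid_sample = prob_space M for M :: "'a measure" +
  fixes X :: "nat \<Rightarrow> 'a \<Rightarrow> real" and \<mu> :: "real measure"
  assumes indep: "indep_vars (\<lambda>_. borel) X {1..}"
    and distr_X: "\<And>i. 1 \<le> i \<Longrightarrow> distr M borel (X i) = \<mu>"
begin

lemma measurable_X [measurable (raw)]: "1 \<le> i \<Longrightarrow> X i \<in> borel_measurable M"
  using indep by (auto simp: indep_vars_def2)

sublocale \<mu>: cdf_distribution \<mu>
  unfolding cdf_distribution_def distr_X[OF order_refl, symmetric]
  by (rule real_distribution_distr) (simp add: measurable_X)

text \<open>The integral of \<open>g\<close> against the empirical law. Indicators of half-lines
  give the empirical cdf, and positive parts give the averages in \<phi>. For \<open>n = 0\<close>
  division by zero yields 0.\<close>

definition sample_mean :: "(real \<Rightarrow> real) \<Rightarrow> nat \<Rightarrow> 'a \<Rightarrow> real" where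
  "sample_mean g n \<omega> = (\<Sum>i=1..n. g (X i \<omega>)) / real n"

lemma measurable_sample_mean [measurable (raw)]:
  assumes [measurable]: "g \<in> borel_measurable borel"
  shows "sample_mean g n \<in> borel_measurable M"
proof -
  have "(\<lambda>\<omega>. g (X i \<omega>)) \<in> borel_measurable M" if "i \<in> {1..n}" for i
    using that by (intro measurable_compose[OF measurable_X]) auto
  then show ?thesis
    unfolding sample_mean_def by (intro borel_measurable_divide borel_measurable_sum) auto
qed

lemma integrable_X_iff:
  fixes g :: "real \<Rightarrow> real"
  assumes "1 \<le> i" "g \<in> borel_measurable borel"
  shows "integrable M (\<lambda>\<omega>. g (X i \<omega>)) \<longleftrightarrow> integrable \<mu> g"
  using assms by (subst distr_X[OF assms(1), symmetric], subst integrable_distr_eq) auto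

lemma expectation_X:
  fixes g :: "real \<Rightarrow> real"
  assumes "1 \<le> i" "g \<in> borel_measurable borel"
  shows "expectation (\<lambda>\<omega>. g (X i \<omega>)) = integral\<^sup>L \<mu> g"
  using assms by (subst distr_X[OF assms(1), symmetric], subst integral_distr) auto

text \<open>After centring, the second moment of the sum is \<open>n\<close> times the variance of
  \<open>g\<close>, which is at most its second moment; the square root of the second moment bounds
  the mean absolute value.\<close>

lemma expectation_abs_sample_mean_le:
  assumes [measurable]: "g \<in> borel_measurable borel" and n: "1 \<le> n"
    and i2: "integrable \<mu> (\<lambda>x. (g x)\<^sup>2)"
  shows "expectation (\<lambda>\<omega>. \<bar>sample_mean g n \<omega> - integral\<^sup>L \<mu> g\<bar>) \<le> sqrt (\<integral>x. (g x)\<^sup>2 \<partial>\<mu>) / sqrt n"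
proof -
  define m where "m = integral\<^sup>L \<mu> g"
  have [measurable]: "g \<in> borel_measurable \<mu>" by simp
  have i1: "integrable \<mu> g"
    by (rule \<mu>.square_integrable_imp_integrable[OF _ i2]) simp
  define Z where "Z i \<omega> = g (X i \<omega>) - m" for i \<omega>
  have i2': "integrable \<mu> (\<lambda>x. (g x - m)\<^sup>2)"
    using i1 i2 by (simp add: power2_diff)
  have var: "(\<integral>x. (g x - m)\<^sup>2 \<partial>\<mu>) \<le> (\<integral>x. (g x)\<^sup>2 \<partial>\<mu>)"
    using \<mu>.variance_eq[OF i1 i2] by (simp add: m_def)
  have "indep_vars (\<lambda>_. borel) Z {1..}"
    unfolding Z_def by (rule indep_vars_compose2[OF indep]) simp
  then have ind: "indep_vars (\<lambda>_. borel) Z {1..n}"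
    by (rule indep_vars_subset) auto
  have sq: "integrable M (\<lambda>\<omega>. (Z i \<omega>)\<^sup>2)" "expectation (\<lambda>\<omega>. (Z i \<omega>)\<^sup>2) = (\<integral>x. (g x - m)\<^sup>2 \<partial>\<mu>)"
    "expectation (Z i) = 0" if "i \<in> {1..n}" for i
  proof -
    show "integrable M (\<lambda>\<omega>. (Z i \<omega>)\<^sup>2)"
      unfolding Z_def using that i2' integrable_X_iff[of i "\<lambda>x. (g x - m)\<^sup>2"] by auto
    show "expectation (\<lambda>\<omega>. (Z i \<omega>)\<^sup>2) = (\<integral>x. (g x - m)\<^sup>2 \<partial>\<mu>)"
      unfolding Z_def using that expectation_X[of i "\<lambda>x. (g x - m)\<^sup>2"] by auto
    have "expectation (Z i) = (\<integral>x. g x - m \<partial>\<mu>)"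
      unfolding Z_def using that expectation_X[of i "\<lambda>x. g x - m"] by auto
    also have "\<dots> = 0"
      using i1 by (simp add: m_def \<mu>.prob_space del: \<mu>.space_eq_univ)
    finally show "expectation (Z i) = 0" .
  qed
  define W where "W \<omega> = (\<Sum>i=1..n. Z i \<omega>)" for \<omega>
  have [measurable]: "W \<in> borel_measurable M"
    unfolding W_def using ind by (intro borel_measurable_sum) (auto simp: indep_vars_def2)
  have W: "integrable M (\<lambda>\<omega>. (W \<omega>)\<^sup>2)" "expectation (\<lambda>\<omega>. (W \<omega>)\<^sup>2) = n * (\<integral>x. (g x - m)\<^sup>2 \<partial>\<mu>)"
    using sum_indep_square[OF _ ind sq(1,3)] sq(2) by (auto simp: W_def)
  have "sample_mean g n \<omega> - m = W \<omega> / n" for \<omega>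
    using n by (simp add: sample_mean_def W_def Z_def sum_subtractf diff_divide_distrib)
  then have "expectation (\<lambda>\<omega>. \<bar>sample_mean g n \<omega> - m\<bar>) = expectation (\<lambda>\<omega>. \<bar>W \<omega>\<bar>) / n"
    by simp
  also have "\<dots> \<le> sqrt (n * (\<integral>x. (g x - m)\<^sup>2 \<partial>\<mu>)) / n"
    using expectation_abs_le_sqrt[OF _ W(1)] W(2) by (simp add: divide_right_mono)
  also have "\<dots> \<le> sqrt (n * (\<integral>x. (g x)\<^sup>2 \<partial>\<mu>)) / n"
    using var by (intro divide_right_mono real_sqrt_le_mono mult_left_mono) auto
  also have "\<dots> = sqrt (\<integral>x. (g x)\<^sup>2 \<partial>\<mu>) / sqrt n"
    using n by (simp add: real_sqrt_mult field_simps)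
  finally show ?thesis
    by (simp add: m_def)
qed

lemma integrable_sample_mean:
  assumes [measurable]: "g \<in> borel_measurable borel" and "integrable \<mu> g"
  shows "integrable M (sample_mean g n)"
  unfolding sample_mean_def
  by (intro Bochner_Integration.integrable_divide Bochner_Integration.integrable_sum)
     (use assms integrable_X_iff in auto)

text \<open>Truncation: the clamped part \<open>T k\<close> is bounded and obeys the square-root
  rate, while the remainder \<open>V k\<close> is small in mean, uniformly in \<open>n\<close>, by
  dominated convergence.\<close>

theorem weak_law_L1:
  assumes [measurable]: "g \<in> borel_measurable borel" and int: "integrable \<mu> g"
  shows "(\<lambda>n. expectation (\<lambda>\<omega>. \<bar>sample_mean g n \<omega> - integral\<^sup>L \<mu> g\<bar>)) \<longlonglongrightarrow> 0"
proof (rule LIMSEQ_I)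
  fix r :: real assume r: "0 < r"
  define T where "T k x = max (- real k) (min (real k) (g x))" for k x
  define V where "V k x = g x - T k x" for k x
  have [measurable]: "T k \<in> borel_measurable borel" "V k \<in> borel_measurable borel" for k
    unfolding T_def V_def by measurable
  have [measurable]: "g \<in> borel_measurable \<mu>" by simp
  have Vle: "\<bar>V k x\<bar> \<le> \<bar>g x\<bar>" for k x
    by (auto simp: V_def T_def)
  have "(\<lambda>k. V k x) \<longlonglongrightarrow> 0" for x
  proof (rule tendsto_eventually)
    show "\<forall>\<^sub>F k in sequentially. V k x = 0"
      using eventually_ge_at_top[of "nat \<lceil>\<bar>g x\<bar>\<rceil>"]
      by eventually_elim (auto simp: V_def T_def nat_le_iff ceiling_le_iff)
  qed
  then have "(\<lambda>k. \<integral>x. \<bar>V k x\<bar> \<partial>\<mu>) \<longlonglongrightarrow> (\<integral>x. 0 \<partial>\<mu>)"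
    by (intro integral_dominated_convergence[where w = "\<lambda>x. \<bar>g x\<bar>"])
       (use int Vle in \<open>auto intro!: tendsto_rabs_zero\<close>)
  \<comment> \<open>The remainder enters twice, through its sample mean and through its expectation,
    so \<open>r / 4\<close> costs \<open>r / 2\<close> in total.\<close>
  then have "\<forall>\<^sub>F k in sequentially. (\<integral>x. \<bar>V k x\<bar> \<partial>\<mu>) < r / 4"
    using r by (intro order_tendstoD(2)) auto
  then obtain k where k: "(\<integral>x. \<bar>V k x\<bar> \<partial>\<mu>) < r / 4"
    by (auto simp: eventually_sequentially)
  have iV: "integrable \<mu> (V k)"
    by (rule Bochner_Integration.integrable_bound[OF int]) (use Vle in auto)
  have iT: "integrable \<mu> (T k)"
    by (rule \<mu>.integrable_const_bound[of _ "real k"]) (auto simp: T_def)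
  have iT2: "integrable \<mu> (\<lambda>x. (T k x)\<^sup>2)" and T2: "(\<integral>x. (T k x)\<^sup>2 \<partial>\<mu>) \<le> (real k)\<^sup>2"
  proof -
    have le: "(T k x)\<^sup>2 \<le> (real k)\<^sup>2" for x
      by (rule power2_le_iff_abs_le[THEN iffD2]) (auto simp: T_def)
    show i: "integrable \<mu> (\<lambda>x. (T k x)\<^sup>2)"
      by (rule \<mu>.integrable_const_bound[of _ "(real k)\<^sup>2"]) (use le in auto)
    show "(\<integral>x. (T k x)\<^sup>2 \<partial>\<mu>) \<le> (real k)\<^sup>2"
      by (rule \<mu>.integral_le_const[OF i]) (use le in auto)
  qed
  have iMT: "integrable M (sample_mean (T k) n)" and iMV: "integrable M (sample_mean (V k) n)"
    and iMV': "integrable M (sample_mean (\<lambda>x. \<bar>V k x\<bar>) n)" for n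
    using iT iV by (auto intro!: integrable_sample_mean)
  have bound: "expectation (\<lambda>\<omega>. \<bar>sample_mean g n \<omega> - integral\<^sup>L \<mu> g\<bar>) \<le> real k / sqrt n + r / 2"
    if n: "1 \<le> n" for n
  proof -
    have gT: "sample_mean g n \<omega> = sample_mean (T k) n \<omega> + sample_mean (V k) n \<omega>" for \<omega>
      by (simp add: sample_mean_def V_def sum.distrib add_divide_distrib[symmetric] sum_subtractf)
    have intg: "integral\<^sup>L \<mu> g = integral\<^sup>L \<mu> (T k) + integral\<^sup>L \<mu> (V k)"
      using iT iV by (subst Bochner_Integration.integral_add[symmetric]) (auto simp: V_def)
    have absV: "\<bar>sample_mean (V k) n \<omega>\<bar> \<le> sample_mean (\<lambda>x. \<bar>V k x\<bar>) n \<omega>" for \<omega>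
      by (simp add: sample_mean_def abs_divide divide_right_mono sum_abs)
    have "expectation (sample_mean (\<lambda>x. \<bar>V k x\<bar>) n) = (\<Sum>i=1..n. expectation (\<lambda>\<omega>. \<bar>V k (X i \<omega>)\<bar>)) / n"
      unfolding sample_mean_def using iV integrable_X_iff[of _ "\<lambda>x. \<bar>V k x\<bar>"]
      by (subst integral_divide_zero, subst Bochner_Integration.integral_sum) auto
    also have "\<dots> = (\<integral>x. \<bar>V k x\<bar> \<partial>\<mu>)"
      using n expectation_X[of _ "\<lambda>x. \<bar>V k x\<bar>"] by simp
    finally have EV: "expectation (sample_mean (\<lambda>x. \<bar>V k x\<bar>) n) = (\<integral>x. \<bar>V k x\<bar> \<partial>\<mu>)" .
    have "expectation (\<lambda>\<omega>. \<bar>sample_mean g n \<omega> - integral\<^sup>L \<mu> g\<bar>) \<le>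
        expectation (\<lambda>\<omega>. \<bar>sample_mean (T k) n \<omega> - integral\<^sup>L \<mu> (T k)\<bar> +
           (sample_mean (\<lambda>x. \<bar>V k x\<bar>) n \<omega> + (\<integral>x. \<bar>V k x\<bar> \<partial>\<mu>)))"
    proof (rule integral_mono)
      show "integrable M (\<lambda>\<omega>. \<bar>sample_mean g n \<omega> - integral\<^sup>L \<mu> g\<bar>)"
        using integrable_sample_mean[OF _ int] by simp
      fix \<omega>
      show "\<bar>sample_mean g n \<omega> - integral\<^sup>L \<mu> g\<bar> \<le>
        \<bar>sample_mean (T k) n \<omega> - integral\<^sup>L \<mu> (T k)\<bar> +
           (sample_mean (\<lambda>x. \<bar>V k x\<bar>) n \<omega> + (\<integral>x. \<bar>V k x\<bar> \<partial>\<mu>))"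
        using absV[of \<omega>] integral_abs_bound[of \<mu> "V k"] unfolding gT intg by linarith
    qed (use iMT iMV' in auto)
    also have "\<dots> = expectation (\<lambda>\<omega>. \<bar>sample_mean (T k) n \<omega> - integral\<^sup>L \<mu> (T k)\<bar>) +
        2 * (\<integral>x. \<bar>V k x\<bar> \<partial>\<mu>)"
      using iMT iMV' EV by (simp add: prob_space)
    also have "expectation (\<lambda>\<omega>. \<bar>sample_mean (T k) n \<omega> - integral\<^sup>L \<mu> (T k)\<bar>)
       \<le> sqrt (\<integral>x. (T k x)\<^sup>2 \<partial>\<mu>) / sqrt n"
      by (rule expectation_abs_sample_mean_le[OF _ n iT2]) simp
    also have "\<dots> \<le> real k / sqrt n"
      using T2 by (intro divide_right_mono real_le_lsqrt) auto
    finally show ?thesis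
      using k by simp
  qed
  have "(\<lambda>n. real k / sqrt (real n)) \<longlonglongrightarrow> 0"
    by real_asymp
  then have "\<forall>\<^sub>F n in sequentially. real k / sqrt (real n) < r / 2"
    using r by (intro order_tendstoD(2)) auto
  then have "\<forall>\<^sub>F n in sequentially. expectation (\<lambda>\<omega>. \<bar>sample_mean g n \<omega> - integral\<^sup>L \<mu> g\<bar>) < r"
    using eventually_ge_at_top[of 1]
  proof eventually_elim
    case (elim n)
    then show ?case using bound[of n] by linarith
  qed
  then show "\<exists>no. \<forall>n\<ge>no. norm (expectation (\<lambda>\<omega>. \<bar>sample_mean g n \<omega> - integral\<^sup>L \<mu> g\<bar>) - 0) < r"
    by (simp add: eventually_sequentially)
qed

end

section \<open>Characteristic functions: scaling, small perturbations and the normal law\<close>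

lemma (in prob_space) char_distr_scale:
  assumes [measurable]: "W \<in> borel_measurable M"
  shows "char (distr M borel (\<lambda>\<omega>. c * W \<omega>)) t = char (distr M borel W) (c * t)"
  by (simp add: char_def integral_distr mult_ac)

text \<open>The factor \<open>iexp (t * U \<omega>)\<close> has modulus 1, so only the distance of
  \<open>iexp (t * W \<omega>)\<close> from 1 matters. It is at most
  \<open>\<bar>t\<bar> * \<bar>W \<omega>\<bar>\<close>, used where \<open>W\<close> is small, and
  at most 2, used elsewhere.\<close>

lemma (in prob_space) norm_char_distr_add_diff_le:
  assumes [measurable]: "U \<in> borel_measurable M" "W \<in> borel_measurable M" and \<delta>: "0 < \<delta>"
  shows "norm (char (distr M borel (\<lambda>\<omega>. U \<omega> + W \<omega>)) t - char (distr M borel U) t)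
    \<le> \<bar>t\<bar> * \<delta> + 2 * prob {\<omega> \<in> space M. \<delta> < \<bar>W \<omega>\<bar>}"
proof -
  let ?B = "{\<omega> \<in> space M. \<delta> < \<bar>W \<omega>\<bar>}"
  have pt: "norm (iexp (t * (U \<omega> + W \<omega>)) - iexp (t * U \<omega>)) \<le> \<bar>t\<bar> * \<delta> + 2 * indicator ?B \<omega>"
    if "\<omega> \<in> space M" for \<omega>
  proof -
    have "iexp (t * (U \<omega> + W \<omega>)) - iexp (t * U \<omega>) = iexp (t * U \<omega>) * (iexp (t * W \<omega>) - 1)"
      by (simp add: algebra_simps exp_add)
    then have eq: "norm (iexp (t * (U \<omega> + W \<omega>)) - iexp (t * U \<omega>)) = norm (iexp (t * W \<omega>) - 1)"
      by (simp add: norm_mult)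
    have 1: "norm (iexp (t * W \<omega>) - 1) \<le> \<bar>t\<bar> * \<bar>W \<omega>\<bar>"
      using iexp_approx1[of "t * W \<omega>" 0] by (simp add: abs_mult)
    have 2: "norm (iexp (t * W \<omega>) - 1) \<le> 2"
      using iexp_approx2[of "t * W \<omega>" 0] by simp
    show ?thesis
    proof (cases "\<delta> < \<bar>W \<omega>\<bar>")
      case True
      have "0 \<le> \<bar>t\<bar> * \<delta>" using \<delta> by simp
      then show ?thesis using True that 2 unfolding eq by simp
    next
      case False
      then have "\<bar>t\<bar> * \<bar>W \<omega>\<bar> \<le> \<bar>t\<bar> * \<delta>"
        by (intro mult_left_mono) auto
      then show ?thesis using False 1 unfolding eq by simp
    qed
  qed
  have i: "integrable M (\<lambda>\<omega>. iexp (t * (U \<omega> + W \<omega>)))" "integrable M (\<lambda>\<omega>. iexp (t * U \<omega>))"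
    by (auto intro!: integrable_iexp)
  have iB: "integrable M (\<lambda>\<omega>. \<bar>t\<bar> * \<delta> + 2 * indicator ?B \<omega>)"
    by (intro Bochner_Integration.integrable_add integrable_mult_right integrable_const
        integrable_real_indicator) (auto simp: less_top[symmetric])
  have "char (distr M borel (\<lambda>\<omega>. U \<omega> + W \<omega>)) t - char (distr M borel U) t =
      (CLINT \<omega>|M. iexp (t * (U \<omega> + W \<omega>)) - iexp (t * U \<omega>))"
    unfolding char_def by (subst Bochner_Integration.integral_diff[OF i]) (simp add: integral_distr)
  also have "norm \<dots> \<le> (\<integral>\<omega>. norm (iexp (t * (U \<omega> + W \<omega>)) - iexp (t * U \<omega>)) \<partial>M)"
    by (rule integral_norm_bound)
  also have "\<dots> \<le> (\<integral>\<omega>. \<bar>t\<bar> * \<delta> + 2 * indicator ?B \<omega> \<partial>M)"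
    using i iB by (intro integral_mono pt integrable_norm Bochner_Integration.integrable_diff)
  also have "\<dots> = \<bar>t\<bar> * \<delta> + 2 * prob ?B"
    by (subst Bochner_Integration.integral_add)
       (auto simp: prob_space less_top[symmetric] intro!: integrable_mult_right integrable_real_indicator)
  finally show ?thesis .
qed

text \<open>Slutsky's lemma for a perturbation tending to 0 in probability, phrased at a fixed
  \<open>t\<close> so that it feeds directly into Levy's continuity theorem.\<close>

lemma (in prob_space) char_distr_slutsky:
  assumes [measurable]: "\<And>n::nat. U n \<in> borel_measurable M" "\<And>n. W n \<in> borel_measurable M"
    and U: "(\<lambda>n. char (distr M borel (U n)) t) \<longlonglongrightarrow> c"
    and W: "\<And>\<delta>. 0 < \<delta> \<Longrightarrow> (\<lambda>n. prob {\<omega> \<in> space M. \<delta> < \<bar>W n \<omega>\<bar>}) \<longlonglongrightarrow> 0"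
  shows "(\<lambda>n. char (distr M borel (\<lambda>\<omega>. U n \<omega> + W n \<omega>)) t) \<longlonglongrightarrow> c"
proof -
  let ?d = "\<lambda>n. char (distr M borel (\<lambda>\<omega>. U n \<omega> + W n \<omega>)) t - char (distr M borel (U n)) t"
  have "?d \<longlonglongrightarrow> 0"
  proof (rule tendstoI)
    fix e :: real assume e: "0 < e"
    \<comment> \<open>The summand 1 covers \<open>t = 0\<close>. This \<delta> spends half of
      \<open>e\<close>; the probability bound \<open>e / 4\<close>, counted twice, spends the other
      half.\<close>
    define \<delta> where "\<delta> = e / (2 * (\<bar>t\<bar> + 1))"
    have \<delta>: "0 < \<delta>" using e by (simp add: \<delta>_def)
    have "\<bar>t\<bar> * \<delta> \<le> (\<bar>t\<bar> + 1) * \<delta>" using \<delta> by (intro mult_right_mono) auto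
    also have "\<dots> = e / 2" by (simp add: \<delta>_def divide_simps)
    finally have td: "\<bar>t\<bar> * \<delta> \<le> e / 2" .
    have "\<forall>\<^sub>F n in sequentially. prob {\<omega> \<in> space M. \<delta> < \<bar>W n \<omega>\<bar>} < e / 4"
      using e by (intro order_tendstoD(2)[OF W[OF \<delta>]]) auto
    then show "\<forall>\<^sub>F n in sequentially. dist (?d n) 0 < e"
    proof eventually_elim
      case (elim n)
      then show ?case
        using norm_char_distr_add_diff_le[of "U n" "W n" \<delta> t] td \<delta> by simp
    qed
  qed
  from tendsto_add[OF this U] show ?thesis by simp
qed

text \<open>A single formula also covers the degenerate law, whose characteristic function is 1. For
  positive \<open>v\<close> the law is the image of the standard normal law under multiplication by
  \<open>sqrt v\<close>.\<close>

lemma char_normal_distr: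
  assumes "0 \<le> v"
  shows "char (normal_distr 0 v) t = complex_of_real (exp (- (v * t\<^sup>2) / 2))"
    and "real_distribution (normal_distr 0 v)"
proof -
  have "char (normal_distr 0 v) t = complex_of_real (exp (- (v * t\<^sup>2) / 2)) \<and>
    real_distribution (normal_distr 0 v)"
  proof (cases "v = 0")
    case True
    have "prob_space (return borel (0::real))"
      by (rule prob_space_return) simp
    then show ?thesis
      using True by (simp add: normal_distr_def char_def integral_return real_distribution_def
          real_distribution_axioms_def)
  next
    case False
    interpret N: real_distribution std_normal_distribution
      by (rule real_dist_normal_dist)
    have v: "0 < sqrt v" using False assms by simp
    \<comment> \<open>On the standard normal law itself, the identity is a standard normal
      variable.\<close>
    have "distributed std_normal_distribution lborel (\<lambda>x. x) std_normal_density"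
      by (auto simp: distributed_def distr_id2)
    then have "distributed std_normal_distribution lborel (\<lambda>x. sqrt v * x) (normal_density 0 (sqrt v))"
      using N.normal_density_affine[of "\<lambda>x. x" 0 1 "sqrt v" 0] v by simp
    then have "distr std_normal_distribution lborel (\<lambda>x. sqrt v * x) = normal_distr 0 v"
      using False by (simp add: distributed_def normal_distr_def)
    moreover have "distr std_normal_distribution lborel (\<lambda>x. sqrt v * x) =
        distr std_normal_distribution borel (\<lambda>x. sqrt v * x)"
      by (rule distr_cong) auto
    ultimately have eq: "normal_distr 0 v = distr std_normal_distribution borel (\<lambda>x. sqrt v * x)"
      by simp
    have "char (normal_distr 0 v) t = char (distr std_normal_distribution borel (\<lambda>x. x)) (sqrt v * t)"
      unfolding eq by (rule N.char_distr_scale) simp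
    also have "distr std_normal_distribution borel (\<lambda>x. x) = std_normal_distribution"
      by (rule distr_id2) simp
    finally show ?thesis
      using assms unfolding char_std_normal_distribution
      by (simp add: power_mult_distrib eq N.real_distribution_distr)
  qed
  then show "char (normal_distr 0 v) t = complex_of_real (exp (- (v * t\<^sup>2) / 2))"
    "real_distribution (normal_distr 0 v)" by auto
qed

text \<open>Injectivity makes the singletons \<open>{f j}\<close> disjoint blocks of indices, so the
  restrictions to them are independent; projecting each block to its only coordinate preserves this.
  It serves to shift the sample to start at index 0.\<close>

lemma (in prob_space) indep_vars_reindex:
  assumes "indep_vars M' X I" "inj_on f J" "f ` J \<subseteq> I"
  shows "indep_vars (\<lambda>j. M' (f j)) (\<lambda>j. X (f j)) J"
proof -
  have "indep_vars (\<lambda>j. PiM {f j} M') (\<lambda>j \<omega>. restrict (\<lambda>i. X i \<omega>) {f j}) J"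
    using assms by (intro indep_vars_restrict[OF assms(1)])
      (auto simp: disjoint_family_on_def inj_on_def)
  then have "indep_vars (\<lambda>j. M' (f j)) (\<lambda>j \<omega>. (restrict (\<lambda>i. X i \<omega>) {f j}) (f j)) J"
    by (rule indep_vars_compose2) (auto intro!: measurable_component_singleton)
  then show ?thesis by simp
qed

section \<open>The central limit theorem for sample means\<close>

context iid_sample
begin

text \<open>For positive variance this is the classical theorem applied to the shifted sample. Zero
  variance is separate: the centred mean is then almost surely 0 for every \<open>n \<ge> 1\<close>,
  and the claimed limit is 1.\<close>

theorem clt_char:
  assumes [measurable]: "g \<in> borel_measurable borel" and i2: "integrable \<mu> (\<lambda>x. (g x)\<^sup>2)"
  defines "m \<equiv> integral\<^sup>L \<mu> g" and "v \<equiv> \<integral>x. (g x - integral\<^sup>L \<mu> g)\<^sup>2 \<partial>\<mu>"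
  shows "(\<lambda>n. char (distr M borel (\<lambda>\<omega>. sqrt n * (sample_mean g n \<omega> - m))) t)
    \<longlonglongrightarrow> complex_of_real (exp (- (v * t\<^sup>2) / 2))"
proof (cases "v = 0")
  case True
  have [measurable]: "g \<in> borel_measurable \<mu>" by simp
  have i1: "integrable \<mu> g"
    by (rule \<mu>.square_integrable_imp_integrable[OF _ i2]) simp
  let ?h = "\<lambda>x. g x - m"
  have h2: "integrable \<mu> (\<lambda>x. (?h x)\<^sup>2)"
    using i1 i2 by (simp add: power2_diff)
  have h0: "integral\<^sup>L \<mu> ?h = 0"
    using i1 by (simp add: m_def \<mu>.prob_space del: \<mu>.space_eq_univ)
  have v0: "(\<integral>x. (?h x)\<^sup>2 \<partial>\<mu>) = 0"
    using True by (simp add: v_def m_def)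
  have "char (distr M borel (\<lambda>\<omega>. sqrt n * (sample_mean g n \<omega> - m))) t = 1" if n: "1 \<le> n" for n :: nat
  proof -
    have hm: "sample_mean ?h n \<omega> = sample_mean g n \<omega> - m" for \<omega>
      using n by (simp add: sample_mean_def sum_subtractf diff_divide_distrib)
    \<comment> \<open>The mean absolute error bound is applied to the centred function, whose second
      moment is the vanishing variance.\<close>
    have "expectation (\<lambda>\<omega>. \<bar>sample_mean g n \<omega> - m\<bar>) \<le> 0"
      using expectation_abs_sample_mean_le[OF _ n h2] v0 h0 by (simp add: hm)
    then have "expectation (\<lambda>\<omega>. \<bar>sample_mean g n \<omega> - m\<bar>) = 0"
      by (intro antisym) (auto intro: integral_nonneg)
    then have "AE \<omega> in M. \<bar>sample_mean g n \<omega> - m\<bar> = 0"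
      using integrable_sample_mean[OF _ i1, of n]
      by (subst (asm) integral_nonneg_eq_0_iff_AE) auto
    then have "distr M borel (\<lambda>\<omega>. sqrt n * (sample_mean g n \<omega> - m)) = distr M borel (\<lambda>\<omega>. 0)"
      by (intro distr_cong_AE) auto
    then show ?thesis
      by (simp add: char_def integral_distr prob_space del: distr_const)
  qed
  then show ?thesis
    using True by (intro tendsto_eventually eventually_sequentiallyI[of 1]) auto
next
  case False
  have [measurable]: "g \<in> borel_measurable \<mu>" by simp
  have v: "0 < v" using False by (simp add: v_def order.not_eq_order_implies_strict integral_nonneg)
  define Y where "Y i \<omega> = g (X (Suc i) \<omega>)" for i \<omega>
  let ?Z = "\<lambda>n \<omega>. (\<Sum>i<n. Y i \<omega> - m) / sqrt (real n * (sqrt v)\<^sup>2)"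
  have ind: "indep_vars (\<lambda>_. borel) Y UNIV"
    unfolding Y_def
    by (rule indep_vars_compose2[OF indep_vars_reindex[OF indep, of Suc]]) auto
  have [measurable]: "Y i \<in> borel_measurable M" for i
    using ind by (auto simp: indep_vars_def2)
  have Yd: "distr M borel (Y i) = distr \<mu> borel g" for i
    unfolding distr_X[of "Suc i", simplified, symmetric]
    by (subst distr_distr) (auto simp: Y_def[abs_def] comp_def measurable_X)
  have Ym: "expectation (Y i) = m" for i
    unfolding Y_def m_def by (rule expectation_X) auto
  have "weak_conv_m (\<lambda>n. distr M borel (?Z n)) std_normal_distribution"
  proof (rule central_limit_theorem[OF ind Ym _ _ _ Yd])
    show "0 < sqrt v" using v by simp
    show "integrable M (\<lambda>x. (Y i x)\<^sup>2)" for i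
      unfolding Y_def using i2 integrable_X_iff[of "Suc i" "\<lambda>x. (g x)\<^sup>2"] by simp
    show "variance (Y i) = (sqrt v)\<^sup>2" for i
      unfolding Ym using v expectation_X[of "Suc i" "\<lambda>x. (g x - m)\<^sup>2"]
      by (simp add: Y_def v_def m_def)
  qed
  then have "(\<lambda>n. char (distr M borel (?Z n)) (sqrt v * t)) \<longlonglongrightarrow> char std_normal_distribution (sqrt v * t)"
    by (intro levy_continuity1 real_dist_normal_dist) auto
  \<comment> \<open>\<open>?Z n\<close> is standardised, so undoing the standardisation moves the
    factor \<open>sqrt v\<close> into the argument.\<close>
  moreover have "char (distr M borel (?Z n)) (sqrt v * t) =
      char (distr M borel (\<lambda>\<omega>. sqrt n * (sample_mean g n \<omega> - m))) t" for n
  proof -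
    have "sqrt n * (sample_mean g n \<omega> - m) = sqrt v * ?Z n \<omega>" for \<omega>
    proof (cases "n = 0")
      case n: False
      have "(\<Sum>i=1..n. g (X i \<omega>)) = (\<Sum>i<n. Y i \<omega>)"
        unfolding Y_def by (rule sum.reindex_bij_witness[of _ Suc "\<lambda>i. i - 1"]) auto
      then show ?thesis
        using n v by (simp add: sample_mean_def sum_subtractf real_sqrt_mult field_simps)
    qed simp
    then show ?thesis
      by (subst char_distr_scale[symmetric]) auto
  qed
  ultimately show ?thesis
    using v by (simp add: char_std_normal_distribution power_mult_distrib)
qed

end

section \<open>The empirical TVaR\<close>

text \<open>The factor \<open>1 - indicator {..t} x\<close> is 1 exactly when \<open>t < x\<close>,
  so the integral is the length of \<open>{c..<min d x}\<close>.\<close>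

lemma has_bochner_integral_positive_part_diff:
  fixes c d x :: real
  assumes "c \<le> d"
  shows "has_bochner_integral lborel (\<lambda>t. indicator {c..<d} t * (1 - indicator {..t} x))
    (max (x - c) 0 - max (x - d) 0)"
proof -
  have "(\<lambda>t. indicator {c..<d} t * (1 - indicator {..t} x)) = (indicator {c..<min d x} :: real \<Rightarrow> real)"
    by (auto simp: indicator_def fun_eq_iff)
  moreover have "measure lborel {c..<min d x} = max (x - c) 0 - max (x - d) 0"
  proof -
    consider "x \<le> c" | "c < x" "x \<le> d" | "d < x" by linarith
    then show ?thesis
      using assms by cases auto
  qed
  ultimately show ?thesis
    using has_bochner_integral_real_indicator[of "{c..<min d x}" lborel]
    by (cases "c \<le> min d x") auto
qed

context iid_sample
begin

lemma empirical_cdf_eq_sample_mean: "empirical_cdf X n \<omega> x = sample_mean (indicator {..x}) n \<omega>"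
  by (simp add: empirical_cdf_def sample_mean_def indicator_def)

text \<open>Making the empirical cdf the cdf of an actual law lets the results on
  \<open>cdf_distribution\<close> apply for each fixed \<omega>.\<close>

definition empirical_distr :: "nat \<Rightarrow> 'a \<Rightarrow> real measure" where
  "empirical_distr n \<omega> = distr (uniform_count_measure {1..n}) borel (\<lambda>i. X i \<omega>)"

lemma empirical_distr:
  assumes n: "1 \<le> n"
  shows "cdf_distribution (empirical_distr n \<omega>)"
    and "\<And>g :: real \<Rightarrow> real. g \<in> borel_measurable borel \<Longrightarrow> integrable (empirical_distr n \<omega>) g"
    and "\<And>g :: real \<Rightarrow> real. g \<in> borel_measurable borel \<Longrightarrow>
      integral\<^sup>L (empirical_distr n \<omega>) g = sample_mean g n \<omega>"
    and "cdf (empirical_distr n \<omega>) = empirical_cdf X n \<omega>"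
proof -
  let ?U = "uniform_count_measure {1..n}"
  interpret U: prob_space ?U
    by (rule prob_space_uniform_count_measure) (use n in auto)
  have X_measurable [measurable]: "(\<lambda>i. X i \<omega>) \<in> borel_measurable ?U"
    by (rule measurableI) (auto simp: sets_uniform_count_measure space_uniform_count_measure)
  interpret D: real_distribution "empirical_distr n \<omega>"
    unfolding empirical_distr_def by (rule U.real_distribution_distr) (rule X_measurable)
  show "cdf_distribution (empirical_distr n \<omega>)"
    unfolding cdf_distribution_def by (rule D.real_distribution_axioms)
  show "integrable (empirical_distr n \<omega>) g" if "g \<in> borel_measurable borel" for g :: "real \<Rightarrow> real"
  proof -
    have "integrable ?U (\<lambda>i. g (X i \<omega>))"
      by (simp add: uniform_count_measure_def integrable_point_measure_finite)
    then show ?thesis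
      unfolding empirical_distr_def by (subst integrable_distr_eq[OF X_measurable that])
  qed
  show eq: "integral\<^sup>L (empirical_distr n \<omega>) g = sample_mean g n \<omega>"
    if "g \<in> borel_measurable borel" for g :: "real \<Rightarrow> real"
    unfolding empirical_distr_def sample_mean_def using that
    by (subst integral_distr[OF X_measurable]) (simp_all add: integral_uniform_count_measure)
  show "cdf (empirical_distr n \<omega>) = empirical_cdf X n \<omega>"
  proof
    fix x
    have "cdf (empirical_distr n \<omega>) x = integral\<^sup>L (empirical_distr n \<omega>) (indicator {..x})"
      by (simp add: cdf_def)
    also have "\<dots> = empirical_cdf X n \<omega> x"
      by (subst eq) (auto simp: empirical_cdf_eq_sample_mean)
    finally show "cdf (empirical_distr n \<omega>) x = empirical_cdf X n \<omega> x" .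
  qed
qed

text \<open>This is the generalised inverse \<open>I\<close> of the empirical law, kept real-valued
  for use in arithmetic.\<close>

definition empirical_quantile :: "real \<Rightarrow> nat \<Rightarrow> 'a \<Rightarrow> real" where
  "empirical_quantile p n \<omega> = Inf {x. p \<le> empirical_cdf X n \<omega> x}"

text \<open>\<open>pseudoinverse\<close> for the empirical law. It turns events about the empirical
  quantile into events about the empirical cdf at one point, which yields both measurability and
  localisation near the true quantile.\<close>

lemma empirical_quantile_le_iff:
  assumes "1 \<le> n" "0 < p" "p < 1"
  shows "p \<le> empirical_cdf X n \<omega> x \<longleftrightarrow> empirical_quantile p n \<omega> \<le> x"
proof -
  interpret E: cdf_distribution "empirical_distr n \<omega>"
    by (rule empirical_distr) fact
  show ?thesis
    using E.pseudoinverse[of p x] assms unfolding empirical_quantile_def empirical_distr(4)[OF assms(1)]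
    by metis
qed

lemma TVaR_empirical_cdf:
  assumes n: "1 \<le> n" and p: "0 < p" "p < 1"
  defines "c \<equiv> empirical_quantile p n"
  shows "TVaR (empirical_cdf X n \<omega>) p = c \<omega> + sample_mean (\<lambda>x. max (x - c \<omega>) 0) n \<omega> / (1 - p)"
proof -
  interpret E: cdf_distribution "empirical_distr n \<omega>"
    by (rule empirical_distr) fact
  have "TVaR (cdf (empirical_distr n \<omega>)) p = E.I p + integral\<^sup>L (empirical_distr n \<omega>) (\<lambda>x. max (x - E.I p) 0) / (1 - p)"
    by (rule E.TVaR_cdf_eq[OF p]) (rule empirical_distr(2)[OF n], simp)
  also have "E.I p = c \<omega>"
    unfolding c_def empirical_quantile_def empirical_distr(4)[OF n] ..
  finally show ?thesis
    by (simp add: empirical_distr[OF n])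
qed

lemma measurable_empirical_quantile:
  assumes "1 \<le> n" "0 < p" "p < 1"
  shows "empirical_quantile p n \<in> borel_measurable M"
  unfolding borel_measurable_iff_le
proof
  fix x
  have "{\<omega> \<in> space M. empirical_quantile p n \<omega> \<le> x} =
      {\<omega> \<in> space M. p \<le> sample_mean (indicator {..x}) n \<omega>}"
    using assms by (simp add: empirical_quantile_le_iff[symmetric] empirical_cdf_eq_sample_mean)
  also have "\<dots> \<in> sets M"
    by measurable
  finally show "{\<omega> \<in> space M. empirical_quantile p n \<omega> \<le> x} \<in> sets M" .
qed

lemma measurable_TVaR_empirical_cdf:
  assumes p: "0 < p" "p < 1"
  shows "(\<lambda>\<omega>. TVaR (empirical_cdf X n \<omega>) p) \<in> borel_measurable M"
proof (cases "1 \<le> n")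
  case True
  note measurable_empirical_quantile[OF True p, measurable]
  have "(\<lambda>\<omega>. max (X i \<omega> - empirical_quantile p n \<omega>) 0) \<in> borel_measurable M" if "i \<in> {1..n}" for i
  proof -
    have [measurable]: "X i \<in> borel_measurable M"
      using that measurable_X by auto
    show ?thesis by measurable
  qed
  then have [measurable]: "(\<lambda>\<omega>. \<Sum>i=1..n. max (X i \<omega> - empirical_quantile p n \<omega>) 0) \<in> borel_measurable M"
    by (rule borel_measurable_sum)
  show ?thesis
    unfolding TVaR_empirical_cdf[OF True p] sample_mean_def by measurable
next
  case False
  \<comment> \<open>For \<open>n = 0\<close> the factor \<open>1 / real n\<close> is 0, so the TVaR
    is the same constant for every \<omega>.\<close>
  then have "empirical_cdf X n \<omega> = (\<lambda>_. 0)" for \<omega>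
    by (simp add: empirical_cdf_def fun_eq_iff)
  then show ?thesis by simp
qed

text \<open>Joint measurability is what Fubini's theorem requires when the deviation of the
  empirical cdf is integrated over both \<omega> and \<open>t\<close>.\<close>

lemma measurable_empirical_cdf_pair:
  "(\<lambda>(\<omega>, t). empirical_cdf X n \<omega> t) \<in> borel_measurable (M \<Otimes>\<^sub>M borel)"
proof -
  have "(\<lambda>x. if X i (fst x) \<le> snd x then 1 else (0::real)) \<in> borel_measurable (M \<Otimes>\<^sub>M borel)"
    if "i \<in> {1..n}" for i
  proof -
    have [measurable]: "X i \<in> borel_measurable M"
      using that measurable_X by auto
    show ?thesis by measurable
  qed
  then have "(\<lambda>x. (\<Sum>i=1..n. if X i (fst x) \<le> snd x then 1 else 0) / real n)
      \<in> borel_measurable (M \<Otimes>\<^sub>M borel)"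
    by (intro borel_measurable_divide borel_measurable_sum) auto
  also have "(\<lambda>x. (\<Sum>i=1..n. if X i (fst x) \<le> snd x then 1 else 0) / real n) =
      (\<lambda>(\<omega>, t). empirical_cdf X n \<omega> t)"
    by (auto simp: empirical_cdf_def indicator_def of_bool_def fun_eq_iff split_beta)
  finally show ?thesis .
qed

lemma measurable_empirical_cdf: "empirical_cdf X n \<omega> \<in> borel_measurable borel"
proof -
  have "(\<lambda>t. if X i \<omega> \<le> t then 1 else (0::real)) \<in> borel_measurable borel" for i
    by measurable
  then show ?thesis
    unfolding empirical_cdf_def[abs_def] by (simp add: indicator_def of_bool_def)
qed

lemma empirical_cdf_bounds: "0 \<le> empirical_cdf X n \<omega> t" "empirical_cdf X n \<omega> t \<le> 1"
proof -
  show "0 \<le> empirical_cdf X n \<omega> t"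
    unfolding empirical_cdf_def by (intro mult_nonneg_nonneg sum_nonneg) auto
  have "(\<Sum>i=1..n. indicator {\<omega>'. X i \<omega>' \<le> t} \<omega> :: real) \<le> (\<Sum>i=1..n. 1)"
    by (intro sum_mono) (auto simp: indicator_def)
  then show "empirical_cdf X n \<omega> t \<le> 1"
    unfolding empirical_cdf_def by (cases "n = 0") (auto simp: field_simps)
qed

text \<open>An indicator has second moment at most 1. The bound is uniform in \<open>t\<close> and
  can therefore be integrated over an interval.\<close>

lemma expectation_abs_empirical_cdf_le:
  assumes n: "1 \<le> n"
  shows "expectation (\<lambda>\<omega>. \<bar>empirical_cdf X n \<omega> t - \<mu>.C t\<bar>) \<le> 1 / sqrt n"
proof -
  have i: "integrable \<mu> (\<lambda>x. (indicator {..t} x :: real)\<^sup>2)"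
    by (rule \<mu>.integrable_const_bound[of _ 1]) (auto simp: indicator_def intro!: AE_I2)
  have "(\<integral>x. (indicator {..t} x :: real)\<^sup>2 \<partial>\<mu>) \<le> 1"
    by (rule \<mu>.integral_le_const[OF i]) (auto simp: indicator_def)
  then have "sqrt (\<integral>x. (indicator {..t} x :: real)\<^sup>2 \<partial>\<mu>) / sqrt n \<le> 1 / sqrt n"
    by (intro divide_right_mono) (auto intro: real_sqrt_le_1_iff[THEN iffD2])
  moreover have "integral\<^sup>L \<mu> (indicator {..t}) = \<mu>.C t"
    by (simp add: cdf_def)
  ultimately show ?thesis
    using expectation_abs_sample_mean_le[OF _ n i] by (simp add: empirical_cdf_eq_sample_mean)
qed

lemma integrable_abs_empirical_cdf_diff:
  "integrable M (\<lambda>\<omega>. \<bar>empirical_cdf X n \<omega> t - \<mu>.C t\<bar>)"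
  unfolding empirical_cdf_eq_sample_mean
  by (intro integrable_abs Bochner_Integration.integrable_diff integrable_sample_mean)
     (auto intro!: \<mu>.integrable_const_bound[of _ 1])

lemma abs_empirical_cdf_diff_le: "\<bar>empirical_cdf X n \<omega> t - \<mu>.C t\<bar> \<le> 1"
  using empirical_cdf_bounds[of n \<omega> t] \<mu>.cdf_nonneg[of t] \<mu>.cdf_bounded_prob[of t] by linarith

section \<open>Integrated deviation of the empirical cdf\<close>

definition L1_dist :: "real set \<Rightarrow> nat \<Rightarrow> 'a \<Rightarrow> real" where
  "L1_dist S n \<omega> = (\<integral>t. indicator S t * \<bar>empirical_cdf X n \<omega> t - \<mu>.C t\<bar> \<partial>lborel)"

text \<open>Fubini's theorem moves the expectation inside, where the pointwise rate is integrated
  over an interval of length \<open>v - u\<close>. It applies because the integrand is at most 1 and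
  vanishes off a set of finite measure.\<close>

lemma
  assumes n: "1 \<le> n" and uv: "u \<le> v"
  shows integrable_L1_dist: "integrable M (L1_dist {u..v} n)"
    and expectation_L1_dist_le: "expectation (L1_dist {u..v} n) \<le> (v - u) / sqrt n"
proof -
  interpret P: pair_sigma_finite M lborel
    by standard
  let ?f = "\<lambda>(\<omega>, t). indicator {u..v} t * \<bar>empirical_cdf X n \<omega> t - \<mu>.C t\<bar>"
  have [measurable]: "(\<lambda>(\<omega>, t). empirical_cdf X n \<omega> t) \<in> borel_measurable (M \<Otimes>\<^sub>M lborel)"
    using measurable_empirical_cdf_pair[of n] by (simp cong: measurable_cong_sets sets_pair_measure_cong)
  have [measurable]: "?f \<in> borel_measurable (M \<Otimes>\<^sub>M lborel)"
    using \<mu>.measurable_C by measurable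
  have i: "integrable (M \<Otimes>\<^sub>M lborel) ?f"
  proof (rule integrableI_bounded_set)
    show "space M \<times> {u..v} \<in> sets (M \<Otimes>\<^sub>M lborel)"
      by auto
    show "emeasure (M \<Otimes>\<^sub>M lborel) (space M \<times> {u..v}) < \<infinity>"
      using uv by (subst lborel.emeasure_pair_measure_Times) (auto simp: emeasure_space_1)
    show "AE x in M \<Otimes>\<^sub>M lborel. x \<in> space M \<times> {u..v} \<longrightarrow> norm (?f x) \<le> 1"
      using abs_empirical_cdf_diff_le by (auto simp: abs_mult)
    show "AE x in M \<Otimes>\<^sub>M lborel. x \<notin> space M \<times> {u..v} \<longrightarrow> ?f x = 0"
      by (rule AE_I2) (auto simp: space_pair_measure indicator_def)
  qed simp
  show "integrable M (L1_dist {u..v} n)"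
    unfolding L1_dist_def using P.integrable_fst'[OF i] by simp
  have "expectation (L1_dist {u..v} n) = (\<integral>t. (\<integral>\<omega>. indicator {u..v} t * \<bar>empirical_cdf X n \<omega> t - \<mu>.C t\<bar> \<partial>M) \<partial>lborel)"
    unfolding L1_dist_def by (rule P.Fubini_integral[OF i, symmetric])
  also have "\<dots> \<le> (\<integral>t. indicator {u..v} t * (1 / sqrt n) \<partial>lborel)"
  proof (rule integral_mono)
    show "integrable lborel (\<lambda>t. \<integral>\<omega>. indicator {u..v} t * \<bar>empirical_cdf X n \<omega> t - \<mu>.C t\<bar> \<partial>M)"
      by (rule P.integrable_snd[OF i])
    show "integrable lborel (\<lambda>t. indicator {u..v} t * (1 / sqrt n))"
      using uv by (intro integrable_mult_left integrable_real_indicator) auto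
  qed (use expectation_abs_empirical_cdf_le[OF n] in \<open>auto intro!: mult_left_mono simp del: times_divide_eq_right\<close>)
  also have "\<dots> = (v - u) / sqrt n"
    using uv by simp
  finally show "expectation (L1_dist {u..v} n) \<le> (v - u) / sqrt n" .
qed

text \<open>The error \<open>\<phi>(a) - \<phi>(c)\<close> of the introduction.\<close>

definition gap :: "real \<Rightarrow> nat \<Rightarrow> 'a \<Rightarrow> real" where
  "gap p n \<omega> = (1 - p) * \<mu>.I p + sample_mean (\<lambda>x. max (x - \<mu>.I p) 0) n \<omega>
     - (1 - p) * TVaR (empirical_cdf X n \<omega>) p"

section \<open>Bounds on the replacement error\<close>

lemma measurable_gap:
  assumes "0 < p" "p < 1"
  shows "gap p n \<in> borel_measurable M"
  unfolding gap_def[abs_def] using measurable_TVaR_empirical_cdf[OF assms, measurable] by measurable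

text \<open>The value is \<open>\<phi>(d) - \<phi>(c)\<close>. The function \<phi> is piecewise
  linear with right derivative \<open>(1 - p) - (1 - F_n) = F_n - p\<close>, obtained by averaging
  the one-point formula over the sample.\<close>

lemma sample_mean_positive_part_diff:
  assumes n: "1 \<le> n" and cd: "c \<le> d"
  shows "has_bochner_integral lborel (\<lambda>t. indicator {c..<d} t * (empirical_cdf X n \<omega> t - p))
    (((1 - p) * d + sample_mean (\<lambda>x. max (x - d) 0) n \<omega>) -
     ((1 - p) * c + sample_mean (\<lambda>x. max (x - c) 0) n \<omega>))"
proof -
  have 1: "has_bochner_integral lborel
     (\<lambda>t. (\<Sum>i=1..n. indicator {c..<d} t * (1 - indicator {..t} (X i \<omega>))) / real n)
     ((\<Sum>i=1..n. max (X i \<omega> - c) 0 - max (X i \<omega> - d) 0) / real n)"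
    by (intro has_bochner_integral_divide_zero has_bochner_integral_sum
        has_bochner_integral_positive_part_diff cd)
  have 2: "has_bochner_integral lborel (\<lambda>t. indicator {c..<d} t * (1 - p)) ((d - c) * (1 - p))"
    using cd by (intro has_bochner_integral_mult_left)
      (auto simp: has_bochner_integral_iff)
  have "(\<lambda>t. indicator {c..<d} t * (empirical_cdf X n \<omega> t - p)) =
     (\<lambda>t. indicator {c..<d} t * (1 - p) -
       (\<Sum>i=1..n. indicator {c..<d} t * (1 - indicator {..t} (X i \<omega>))) / real n)"
    using n by (auto simp: fun_eq_iff empirical_cdf_eq_sample_mean sample_mean_def
        sum_distrib_left[symmetric] sum_subtractf field_simps indicator_def)
  moreover have "((1 - p) * d + sample_mean (\<lambda>x. max (x - d) 0) n \<omega>) -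
     ((1 - p) * c + sample_mean (\<lambda>x. max (x - c) 0) n \<omega>) =
     (d - c) * (1 - p) - (\<Sum>i=1..n. max (X i \<omega> - c) 0 - max (X i \<omega> - d) 0) / real n"
    by (simp add: sample_mean_def sum_subtractf diff_divide_distrib algebra_simps)
  ultimately show ?thesis
    using has_bochner_integral_diff[OF 2 1] by simp
qed

lemma abs_gap_le_L1_dist:
  assumes n: "1 \<le> n" and p: "0 < p" "p < 1"
    and K: "\<bar>empirical_quantile p n \<omega> - \<mu>.I p\<bar> \<le> K"
  shows "\<bar>gap p n \<omega>\<bar> \<le> L1_dist {\<mu>.I p - K..\<mu>.I p + K} n \<omega>"
proof -
  define a where "a = \<mu>.I p"
  define c where "c = empirical_quantile p n \<omega>"
  define \<phi> where "\<phi> d = (1 - p) * d + sample_mean (\<lambda>x. max (x - d) 0) n \<omega>" for d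
  let ?G = "empirical_cdf X n \<omega>" and ?F = "\<mu>.C"
  have G: "p \<le> ?G t \<longleftrightarrow> c \<le> t" for t
    unfolding c_def by (rule empirical_quantile_le_iff[OF n p])
  have F: "p \<le> ?F t \<longleftrightarrow> a \<le> t" for t
    unfolding a_def by (rule \<mu>.pseudoinverse[OF p])
  have gap: "gap p n \<omega> = \<phi> a - \<phi> c"
    using p by (simp add: gap_def \<phi>_def TVaR_empirical_cdf[OF n p] a_def c_def distrib_left)
  \<comment> \<open>The order of the two quantiles affects only the sign of the error.\<close>
  define l where "l = min a c"
  define u where "u = max a c"
  have hb: "has_bochner_integral lborel (\<lambda>t. indicator {l..<u} t * (?G t - p)) (\<phi> u - \<phi> l)"
    unfolding \<phi>_def by (rule sample_mean_positive_part_diff[OF n]) (simp add: l_def u_def)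
  have "\<bar>gap p n \<omega>\<bar> = \<bar>\<phi> u - \<phi> l\<bar>"
    by (auto simp: gap l_def u_def min_def max_def)
  also have "\<dots> = \<bar>\<integral>t. indicator {l..<u} t * (?G t - p) \<partial>lborel\<bar>"
    using hb by (simp add: has_bochner_integral_iff)
  also have "\<dots> \<le> (\<integral>t. \<bar>indicator {l..<u} t * (?G t - p)\<bar> \<partial>lborel)"
    by (rule integral_abs_bound)
  also have "\<dots> \<le> (\<integral>t. indicator {a - K..a + K} t * \<bar>?G t - ?F t\<bar> \<partial>lborel)"
  proof (rule integral_mono)
    show "integrable lborel (\<lambda>t. \<bar>indicator {l..<u} t * (?G t - p)\<bar>)"
      using hb by (auto simp: has_bochner_integral_iff)
    have "integrable lborel (\<lambda>t. indicator {a - K..a + K} t *\<^sub>R \<bar>?G t - ?F t\<bar>)"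
      using measurable_empirical_cdf[of n \<omega>] \<mu>.measurable_C abs_empirical_cdf_diff_le[of n \<omega>]
      by (intro integrableI_bounded_set_indicator[where B = 1]) (auto simp: emeasure_lborel_Icc_eq)
    then show "integrable lborel (\<lambda>t. indicator {a - K..a + K} t * \<bar>?G t - ?F t\<bar>)"
      by simp
    fix t
    show "\<bar>indicator {l..<u} t * (?G t - p)\<bar> \<le> indicator {a - K..a + K} t * \<bar>?G t - ?F t\<bar>"
    proof (cases "t \<in> {l..<u}")
      case True
      then have "t \<in> {a - K..a + K}"
        using K by (auto simp: l_def u_def a_def[symmetric] c_def[symmetric] min_def max_def abs_le_iff split: if_splits)
      \<comment> \<open>On the half-open interval exactly one of the two cdfs has reached
        \<open>p\<close>, so \<open>p\<close> lies between them.\<close>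
      moreover have "\<bar>?G t - p\<bar> \<le> \<bar>?G t - ?F t\<bar>"
        using True G[of t] F[of t] by (auto simp: l_def u_def min_def max_def split: if_splits)
      ultimately show ?thesis using True by simp
    qed simp
  qed
  finally show ?thesis
    by (simp add: L1_dist_def a_def)
qed

text \<open>The first two terms bound the probability that the empirical quantile leaves the window
  of radius \<open>K\<close>, the last one that the integrated deviation over the window is large.
  If \<epsilon> is itself of order \<open>1 / sqrt n\<close>, the last term remains proportional to
  \<open>K\<close>.\<close>

lemma prob_gap_le:
  assumes n: "1 \<le> n" and p: "0 < p" "p < 1" and K: "0 \<le> K" and \<epsilon>: "0 < \<epsilon>"
    and lower: "\<mu>.C (\<mu>.I p - K) < p" and upper: "p < \<mu>.C (\<mu>.I p + K)"
  shows "prob {\<omega> \<in> space M. \<epsilon> < \<bar>gap p n \<omega>\<bar>} \<le>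
    (1 / (p - \<mu>.C (\<mu>.I p - K)) + 1 / (\<mu>.C (\<mu>.I p + K) - p)) / sqrt n + 2 * K / (\<epsilon> * sqrt n)"
proof -
  define a where "a = \<mu>.I p"
  note [measurable] = measurable_gap[OF p]
  define dl where "dl = p - \<mu>.C (a - K)"
  define du where "du = \<mu>.C (a + K) - p"
  have d: "0 < dl" "0 < du"
    using lower upper by (auto simp: dl_def du_def a_def)
  let ?D = "\<lambda>t \<omega>. \<bar>empirical_cdf X n \<omega> t - \<mu>.C t\<bar>" and ?L = "L1_dist {a - K..a + K} n"
  have [measurable]: "?D t \<in> borel_measurable M" for t
    using integrable_abs_empirical_cdf_diff[of n t] by auto
  have [measurable]: "?L \<in> borel_measurable M"
    using integrable_L1_dist[OF n, of "a - K" "a + K"] K by auto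
  have dev: "prob {\<omega> \<in> space M. \<delta> \<le> ?D t \<omega>} \<le> 1 / \<delta> / sqrt n" if "0 < \<delta>" for \<delta> t
  proof -
    have "prob {\<omega> \<in> space M. \<delta> \<le> ?D t \<omega>} \<le> expectation (?D t) / \<delta>"
      by (rule integral_Markov_inequality_measure[where A = "{}"]) (use that integrable_abs_empirical_cdf_diff in auto)
    also have "\<dots> \<le> (1 / sqrt n) / \<delta>"
      using that by (intro divide_right_mono expectation_abs_empirical_cdf_le n) auto
    finally show ?thesis by (simp add: mult.commute)
  qed
  have L1_nonneg: "0 \<le> ?L \<omega>" for \<omega>
    unfolding L1_dist_def by (intro Bochner_Integration.integral_nonneg) auto
  have "prob {\<omega> \<in> space M. \<epsilon> \<le> ?L \<omega>} \<le> expectation ?L / \<epsilon>"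
    by (rule integral_Markov_inequality_measure[where A = "{}"])
       (use \<epsilon> K integrable_L1_dist[OF n] L1_nonneg in auto)
  also have "\<dots> \<le> (2 * K / sqrt n) / \<epsilon>"
    using expectation_L1_dist_le[OF n, of "a - K" "a + K"] K \<epsilon> by (intro divide_right_mono) auto
  finally have L: "prob {\<omega> \<in> space M. \<epsilon> \<le> ?L \<omega>} \<le> 2 * K / (\<epsilon> * sqrt n)"
    by (simp add: mult.commute)
  \<comment> \<open>A small deviation at \<open>a + K\<close> forces the empirical cdf above
    \<open>p\<close> there and so keeps the empirical quantile at most \<open>a + K\<close>. If the
    quantile still leaves the window, it lies below \<open>a - K\<close>, where the empirical cdf
    must then exceed the true one by at least \<open>dl\<close>.\<close>
  have "{\<omega> \<in> space M. \<epsilon> < \<bar>gap p n \<omega>\<bar>} \<subseteq>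
     {\<omega> \<in> space M. dl \<le> ?D (a - K) \<omega>} \<union> {\<omega> \<in> space M. du \<le> ?D (a + K) \<omega>} \<union>
     {\<omega> \<in> space M. \<epsilon> \<le> ?L \<omega>}"
  proof safe
    fix \<omega> assume *: "\<omega> \<in> space M" "\<epsilon> < \<bar>gap p n \<omega>\<bar>" "\<not> \<epsilon> \<le> ?L \<omega>" "\<not> du \<le> ?D (a + K) \<omega>"
    then have "\<not> \<bar>empirical_quantile p n \<omega> - a\<bar> \<le> K"
      using abs_gap_le_L1_dist[OF n p, of \<omega> K] by (auto simp: a_def)
    moreover have "empirical_quantile p n \<omega> \<le> a + K"
      using * empirical_quantile_le_iff[OF n p, of \<omega> "a + K"] by (auto simp: du_def)
    ultimately have "empirical_quantile p n \<omega> \<le> a - K"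
      by (auto simp: abs_le_iff)
    then have "p \<le> empirical_cdf X n \<omega> (a - K)"
      using empirical_quantile_le_iff[OF n p] by simp
    then show "dl \<le> ?D (a - K) \<omega>"
      by (simp add: dl_def)
  qed
  then have "prob {\<omega> \<in> space M. \<epsilon> < \<bar>gap p n \<omega>\<bar>} \<le>
     prob ({\<omega> \<in> space M. dl \<le> ?D (a - K) \<omega>} \<union> {\<omega> \<in> space M. du \<le> ?D (a + K) \<omega>} \<union>
     {\<omega> \<in> space M. \<epsilon> \<le> ?L \<omega>})"
    by (rule finite_measure_mono) measurable
  also have "\<dots> \<le> prob {\<omega> \<in> space M. dl \<le> ?D (a - K) \<omega>} + prob {\<omega> \<in> space M. du \<le> ?D (a + K) \<omega>} +
     prob {\<omega> \<in> space M. \<epsilon> \<le> ?L \<omega>}"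
    by (intro order_trans[OF measure_Un_le] add_right_mono measure_Un_le) measurable
  also have "\<dots> \<le> (1 / dl + 1 / du) / sqrt n + 2 * K / (\<epsilon> * sqrt n)"
    using dev[OF d(1), of "a - K"] dev[OF d(2), of "a + K"] L by (simp add: add_divide_distrib)
  finally show ?thesis
    by (simp add: dl_def du_def a_def)
qed

end

section \<open>The asymptotic variance\<close>

text \<open>Fubini's theorem: for fixed \<open>x\<close>, the set of \<open>y\<close> with
  \<open>a < y < x\<close> has length \<open>max (x - a) 0\<close>. The weight \<open>W\<close> lets
  the same identity serve for the mean, the inner and the outer integral of the variance
  formula.\<close>

lemma (in cdf_distribution)
  assumes [measurable]: "W \<in> borel_measurable borel"
    and int: "integrable M (\<lambda>x. W x * max (x - a) 0)"
  shows integrable_tail_integral: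
      "integrable lborel (\<lambda>y. indicator {a<..} y * (\<integral>x. W x * indicator {y<..} x \<partial>M))"
    and integral_tail_integral:
      "(\<integral>y. indicator {a<..} y * (\<integral>x. W x * indicator {y<..} x \<partial>M) \<partial>lborel)
        = (\<integral>x. W x * max (x - a) 0 \<partial>M)"
proof -
  interpret P: pair_sigma_finite M lborel
    by standard
  let ?f = "\<lambda>(x, y). indicator {a<..} y * (W x * indicator {y<..} x)"
  have f_eq: "?f (x, y) = W x * indicator {a<..<x} y" for x y
    by (auto simp: indicator_def)
  have meas: "measure lborel {a<..<x} = max (x - a) 0" for x
    by (cases "a \<le> x") auto
  have fin: "integrable lborel (indicator {a<..<x} :: real \<Rightarrow> real)" for x
    by (cases "a \<le> x") (auto intro!: integrable_real_indicator)
  have [measurable]: "?f \<in> borel_measurable (M \<Otimes>\<^sub>M lborel)"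
  proof -
    have "(\<lambda>z. if a < snd z \<and> snd z < fst z then W (fst z) else 0) \<in> borel_measurable (borel \<Otimes>\<^sub>M lborel)"
      by measurable
    also have "(\<lambda>z. if a < snd z \<and> snd z < fst z then W (fst z) else 0) = ?f"
      by (auto simp: indicator_def fun_eq_iff)
    finally show ?thesis
      by (simp cong: measurable_cong_sets sets_pair_measure_cong)
  qed
  have i: "integrable (M \<Otimes>\<^sub>M lborel) ?f"
  proof (rule P.Fubini_integrable)
    have "(\<integral>y. norm (?f (x, y)) \<partial>lborel) = \<bar>W x * max (x - a) 0\<bar>" for x
      unfolding f_eq by (simp add: abs_mult meas)
    then show "integrable M (\<lambda>x. \<integral>y. norm (?f (x, y)) \<partial>lborel)"
      using int by (simp only: integrable_abs)
    show "AE x in M. integrable lborel (\<lambda>y. ?f (x, y))"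
      unfolding f_eq using fin by (intro AE_I2 integrable_mult_right)
  qed simp
  show "integrable lborel (\<lambda>y. indicator {a<..} y * (\<integral>x. W x * indicator {y<..} x \<partial>M))"
    using P.integrable_snd[OF i] by simp
  have "(\<integral>y. indicator {a<..} y * (\<integral>x. W x * indicator {y<..} x \<partial>M) \<partial>lborel) =
      (\<integral>y. (\<integral>x. indicator {a<..} y * (W x * indicator {y<..} x) \<partial>M) \<partial>lborel)"
    by simp
  also have "\<dots> = (\<integral>x. (\<integral>y. ?f (x, y) \<partial>lborel) \<partial>M)"
    using P.Fubini_integral[OF i] by simp
  also have "\<dots> = (\<integral>x. W x * max (x - a) 0 \<partial>M)"
    unfolding f_eq by (simp add: meas)
  finally show "(\<integral>y. indicator {a<..} y * (\<integral>x. W x * indicator {y<..} x \<partial>M) \<partial>lborel)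
        = (\<integral>x. W x * max (x - a) 0 \<partial>M)" .
qed

text \<open>Hoeffding's covariance formula for \<open>Y\<close> with itself. The inner integral
  gives the covariance of \<open>Y\<close> with the indicator of \<open>{y<..}\<close>; integrating
  over \<open>y\<close> replaces that indicator by \<open>Y\<close>.\<close>

lemma (in cdf_distribution) TVaR_variance_cdf_eq:
  assumes p: "0 < p" "p < 1"
  defines "Y \<equiv> \<lambda>x. max (x - I p) 0"
  assumes Y2: "integrable M (\<lambda>x. (Y x)\<^sup>2)"
  shows "TVaR_variance C p = (\<integral>x. (Y x / (1 - p) - (\<integral>x. Y x / (1 - p) \<partial>M))\<^sup>2 \<partial>M)"
proof -
  define a where "a = I p"
  define m where "m = integral\<^sup>L M Y"
  have Y: "Y x = max (x - a) 0" for x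
    by (simp add: Y_def a_def)
  have [measurable]: "Y \<in> borel_measurable borel"
    unfolding Y_def by measurable
  have iY: "integrable M Y"
    by (rule square_integrable_imp_integrable[OF _ Y2]) simp
  have tail: "1 - C t = (\<integral>x. indicator {t<..} x \<partial>M)" for t
  proof -
    have "{t<..} = space M - {..t}" by auto
    then have "prob {t<..} = 1 - prob {..t}"
      using prob_compl[of "{..t}"] by simp
    then show ?thesis
      by (simp add: cdf_def)
  qed
  have one: "integrable lborel (\<lambda>y. indicator {a<..} y * (1 - C y))"
      "(\<integral>y. indicator {a<..} y * (1 - C y) \<partial>lborel) = m"
    using integrable_tail_integral[of "\<lambda>_. 1" a] integral_tail_integral[of "\<lambda>_. 1" a] iY
    by (auto simp: tail m_def Y[abs_def])
  have inner: "(LBINT x=ereal a..\<infinity>. C (min x y) - C x * C y) =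
      (\<integral>x. Y x * indicator {y<..} x \<partial>M) - m * (1 - C y)" for y
  proof -
    have iW: "integrable M (\<lambda>x. indicator {y<..} x * max (x - a) 0)"
      using integrable_mult_indicator[OF _ iY, of "{y<..}"] by (simp add: Y[abs_def])
    \<comment> \<open>\<open>F(x \<and> y) - F(x) F(y) = H(x \<or> y) - H(x) H(y)\<close> for the tail function \<open>H = 1 - F\<close>.\<close>
    have eq: "indicator {a<..} x *\<^sub>R (C (min x y) - C x * C y) =
        indicator {a<..} x * (\<integral>z. indicator {y<..} z * indicator {x<..} z \<partial>M)
        - indicator {a<..} x * (1 - C x) * (1 - C y)" for x
    proof -
      have "(\<integral>z. indicator {y<..} z * indicator {x<..} z \<partial>M) = 1 - C (max x y)"
        unfolding tail by (intro Bochner_Integration.integral_cong) (auto simp: indicator_def)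
      moreover have "C (min x y) + C (max x y) = C x + C y"
        by (simp add: min_def max_def)
      ultimately show ?thesis
        by (simp add: indicator_def algebra_simps)
    qed
    have "(LBINT x=ereal a..\<infinity>. C (min x y) - C x * C y) =
        (\<integral>x. indicator {a<..} x *\<^sub>R (C (min x y) - C x * C y) \<partial>lborel)"
      by (simp add: interval_lebesgue_integral_def set_lebesgue_integral_def)
    also have "\<dots> = (\<integral>x. indicator {y<..} x * max (x - a) 0 \<partial>M) - m * (1 - C y)"
      unfolding eq using integrable_tail_integral[OF _ iW] integral_tail_integral[OF _ iW] one
      by (subst Bochner_Integration.integral_diff) (auto intro!: integrable_mult_left)
    finally show ?thesis
      by (simp add: Y mult.commute)
  qed
  have iYY: "integrable M (\<lambda>x. Y x * max (x - a) 0)"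
    using Y2 by (simp add: Y power2_eq_square)
  have "(LBINT y=ereal a..\<infinity>. (LBINT x=ereal a..\<infinity>. C (min x y) - C x * C y)) =
      (\<integral>y. indicator {a<..} y * (\<integral>x. Y x * indicator {y<..} x \<partial>M)
         - m * (indicator {a<..} y * (1 - C y)) \<partial>lborel)"
    unfolding inner
    by (simp add: interval_lebesgue_integral_def set_lebesgue_integral_def algebra_simps)
  also have "\<dots> = (\<integral>x. (Y x)\<^sup>2 \<partial>M) - m\<^sup>2"
    using integrable_tail_integral[OF _ iYY] integral_tail_integral[OF _ iYY] one
    by (subst Bochner_Integration.integral_diff) (auto simp: Y power2_eq_square)
  also have "\<dots> = variance Y"
    using variance_eq[OF iY Y2] by (simp add: m_def)
  finally have "TVaR_variance C p = variance Y / (1 - p)\<^sup>2"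
    using p quantile_eq_I[of p] by (simp add: TVaR_variance_def a_def)
  also have "\<dots> = (\<integral>x. (Y x / (1 - p) - (\<integral>x. Y x / (1 - p) \<partial>M))\<^sup>2 \<partial>M)"
    by (simp add: diff_divide_distrib[symmetric] power_divide)
  finally show ?thesis .
qed

section \<open>Consistency and asymptotic normality\<close>

text \<open>If the cdf were still at most \<open>p\<close> at some \<open>x\<close> beyond
  \<open>I p\<close>, every quantile at a level above \<open>p\<close> would exceed
  \<open>x\<close>, and the quantile function would jump at \<open>p\<close>. Continuity thus allows
  windows of arbitrarily small radius.\<close>

lemma (in cdf_distribution) cdf_gt_of_isCont_quantile:
  assumes p: "0 < p" "p < 1" and cont: "isCont (quantile C) p" and x: "I p < x"
  shows "p < C x"
proof (rule ccontr)
  assume "\<not> p < C x"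
  have lim: "(quantile C \<longlongrightarrow> quantile C p) (at_right p)"
    using cont by (auto simp: isCont_def intro: tendsto_within_subset)
  have "\<forall>\<^sub>F u in at_right p. u < 1"
    using p by (auto simp: eventually_at_right intro!: exI[of _ 1])
  then have "\<forall>\<^sub>F u in at_right p. ereal x \<le> quantile C u"
    using eventually_at_right_less[of p]
  proof eventually_elim
    case (elim u)
    then have "\<not> u \<le> C x"
      using \<open>\<not> p < C x\<close> by simp
    then have "x < I u"
      using pseudoinverse[of u x] elim p by (simp add: not_le)
    then show ?case
      using quantile_eq_I[of u] elim p by simp
  qed
  then have "ereal x \<le> quantile C p"
    using tendsto_lowerbound[OF lim] by simp
  then show False
    using x quantile_eq_I[of p] p by simp
qed

context iid_sample
begin

text \<open>Common starting point of both limit theorems: the centred sample mean carries the limit,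
  and \<open>gap\<close> has to be negligible at the matching scale.\<close>

lemma TVaR_diff_eq:
  assumes p: "0 < p" "p < 1" and n: "1 \<le> n" and int: "integrable \<mu> (\<lambda>x. max (x - \<mu>.I p) 0)"
  shows "TVaR (empirical_cdf X n \<omega>) p - TVaR \<mu>.C p =
    (sample_mean (\<lambda>x. max (x - \<mu>.I p) 0) n \<omega> - (\<integral>x. max (x - \<mu>.I p) 0 \<partial>\<mu>) - gap p n \<omega>) / (1 - p)"
proof -
  have "TVaR (empirical_cdf X n \<omega>) p =
      \<mu>.I p + (sample_mean (\<lambda>x. max (x - \<mu>.I p) 0) n \<omega> - gap p n \<omega>) / (1 - p)"
    using p unfolding gap_def by (simp add: field_simps)
  then show ?thesis
    unfolding \<mu>.TVaR_cdf_eq[OF p int] by (simp add: diff_divide_distrib)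
qed

theorem TVaR_consistent:
  assumes p: "0 < p" "p < 1" and int: "integrable \<mu> (\<lambda>x. max (x - \<mu>.I p) 0)"
  shows "conv_in_prob M (\<lambda>n \<omega>. TVaR (empirical_cdf X n \<omega>) p) (\<lambda>_. TVaR \<mu>.C p)"
  unfolding conv_in_prob_def
proof (intro conjI allI impI)
  show "(\<lambda>\<omega>. TVaR (empirical_cdf X n \<omega>) p) \<in> borel_measurable M" for n
    by (rule measurable_TVaR_empirical_cdf[OF p])
  fix \<epsilon> :: real assume \<epsilon>: "0 < \<epsilon>"
  \<comment> \<open>Multiplying by \<open>1 - p\<close> leaves \<open>2 * \<delta>\<close>, shared
    equally between the centred mean and the gap.\<close>
  define \<delta> where "\<delta> = \<epsilon> * (1 - p) / 2"
  have \<delta>: "0 < \<delta>" using \<epsilon> p by (simp add: \<delta>_def)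
  define a where "a = \<mu>.I p"
  let ?Y = "\<lambda>x. max (x - a) 0"
  have intY: "integrable \<mu> ?Y"
    using int by (simp add: a_def)
  obtain b where b: "p < \<mu>.C b"
    using eventually_happens'[OF trivial_limit_at_top_linorder order_tendstoD(1)[OF \<mu>.cdf_lim_at_top_prob p(2)]]
    by auto
  \<comment> \<open>The right end of the window lies beyond \<open>b\<close>, where the cdf exceeds
    \<open>p\<close>; the summand 1 puts the left end strictly below the quantile.\<close>
  define K where "K = \<bar>b - a\<bar> + 1"
  have K: "0 \<le> K" by (simp add: K_def)
  have lower: "\<mu>.C (\<mu>.I p - K) < p"
    using \<mu>.pseudoinverse[OF p, of "\<mu>.I p - K"] by (simp add: K_def not_le[symmetric])
  have "\<mu>.C b \<le> \<mu>.C (\<mu>.I p + K)"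
    by (rule \<mu>.cdf_nondecreasing) (simp add: K_def a_def)
  then have upper: "p < \<mu>.C (\<mu>.I p + K)"
    using b by simp
  define B where "B = 1 / (p - \<mu>.C (\<mu>.I p - K)) + 1 / (\<mu>.C (\<mu>.I p + K) - p)"
  let ?E = "\<lambda>n. expectation (\<lambda>\<omega>. \<bar>sample_mean ?Y n \<omega> - integral\<^sup>L \<mu> ?Y\<bar>)"
  note [measurable] = measurable_gap[OF p]
  have bound: "measure M {\<omega> \<in> space M. \<epsilon> < \<bar>TVaR (empirical_cdf X n \<omega>) p - TVaR \<mu>.C p\<bar>}
      \<le> ?E n / \<delta> + (B / sqrt n + 2 * K / (\<delta> * sqrt n))" if n: "1 \<le> n" for n
  proof -
    let ?S = "{\<omega> \<in> space M. \<delta> \<le> \<bar>sample_mean ?Y n \<omega> - integral\<^sup>L \<mu> ?Y\<bar>}"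
    let ?R = "{\<omega> \<in> space M. \<delta> < \<bar>gap p n \<omega>\<bar>}"
    have "measure M {\<omega> \<in> space M. \<epsilon> < \<bar>TVaR (empirical_cdf X n \<omega>) p - TVaR \<mu>.C p\<bar>} \<le> measure M (?S \<union> ?R)"
    proof (rule finite_measure_mono)
      show "{\<omega> \<in> space M. \<epsilon> < \<bar>TVaR (empirical_cdf X n \<omega>) p - TVaR \<mu>.C p\<bar>} \<subseteq> ?S \<union> ?R"
      proof safe
        fix \<omega> assume *: "\<epsilon> < \<bar>TVaR (empirical_cdf X n \<omega>) p - TVaR \<mu>.C p\<bar>" "\<not> \<delta> < \<bar>gap p n \<omega>\<bar>"
        have "2 * \<delta> < \<bar>sample_mean ?Y n \<omega> - integral\<^sup>L \<mu> ?Y - gap p n \<omega>\<bar>"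
          using *(1) p unfolding TVaR_diff_eq[OF p n int]
          by (simp add: a_def \<delta>_def abs_divide pos_less_divide_eq)
        then show "\<delta> \<le> \<bar>sample_mean ?Y n \<omega> - integral\<^sup>L \<mu> ?Y\<bar>"
          using *(2) by linarith
      qed
    qed measurable
    also have "\<dots> \<le> measure M ?S + measure M ?R"
      by (rule measure_Un_le) measurable
    also have "measure M ?S \<le> ?E n / \<delta>"
      by (rule integral_Markov_inequality_measure[where A = "{}"])
         (use \<delta> integrable_sample_mean[OF _ intY] in auto)
    also have "measure M ?R \<le> B / sqrt n + 2 * K / (\<delta> * sqrt n)"
      unfolding B_def by (rule prob_gap_le[OF n p K \<delta> lower upper])
    finally show ?thesis by simp
  qed
  have "(\<lambda>n. B / sqrt (real n) + 2 * K / (\<delta> * sqrt (real n))) \<longlonglongrightarrow> 0"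
    using \<delta> by real_asymp
  then have "(\<lambda>n. ?E n / \<delta> + (B / sqrt n + 2 * K / (\<delta> * sqrt n))) \<longlonglongrightarrow> 0"
    using tendsto_add[OF tendsto_divide[OF weak_law_L1[OF _ intY] tendsto_const[of \<delta>]]] \<delta> by fastforce
  then show "(\<lambda>n. measure M {\<omega> \<in> space M. \<epsilon> < \<bar>TVaR (empirical_cdf X n \<omega>) p - TVaR \<mu>.C p\<bar>}) \<longlonglongrightarrow> 0"
    by (rule Lim_null_comparison[rotated])
       (use bound in \<open>auto intro!: eventually_sequentiallyI[of 1]\<close>)
qed simp

text \<open>The rescaled error splits into \<open>U\<close>, governed by the central limit theorem,
  and \<open>W\<close>, the rescaled gap, which tends to 0 in probability. Characteristic functions
  combine the two through Slutsky's lemma and Levy's continuity theorem.\<close>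

theorem TVaR_asymptotically_normal:
  assumes p: "0 < p" "p < 1" and int2: "integrable \<mu> (\<lambda>x. (max (x - \<mu>.I p) 0)\<^sup>2)"
    and cont: "isCont (quantile \<mu>.C) p"
  shows "conv_in_distr M (\<lambda>n \<omega>. sqrt (real n) * (TVaR (empirical_cdf X n \<omega>) p - TVaR \<mu>.C p))
     (normal_distr 0 (TVaR_variance \<mu>.C p))"
proof -
  let ?T = "\<lambda>n \<omega>. sqrt (real n) * (TVaR (empirical_cdf X n \<omega>) p - TVaR \<mu>.C p)"
  \<comment> \<open>Dividing by \<open>1 - p\<close> here makes the variance of \<open>g\<close>
    equal to \<open>TVaR_variance\<close> with its prefactor included.\<close>
  define g where "g x = max (x - \<mu>.I p) 0 / (1 - p)" for x
  have [measurable]: "g \<in> borel_measurable borel"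
    unfolding g_def by measurable
  have int: "integrable \<mu> (\<lambda>x. max (x - \<mu>.I p) 0)"
    by (rule \<mu>.square_integrable_imp_integrable[OF _ int2]) simp
  have g2: "integrable \<mu> (\<lambda>x. (g x)\<^sup>2)"
    using int2 by (simp add: g_def power_divide)
  define v where "v = (\<integral>x. (g x - integral\<^sup>L \<mu> g)\<^sup>2 \<partial>\<mu>)"
  have v0: "0 \<le> v" by (simp add: v_def)
  have v_eq: "TVaR_variance \<mu>.C p = v"
    unfolding v_def g_def by (rule \<mu>.TVaR_variance_cdf_eq[OF p int2])
  note [measurable] = measurable_gap[OF p] measurable_TVaR_empirical_cdf[OF p]
  define U where "U n \<omega> = sqrt (real n) * (sample_mean g n \<omega> - integral\<^sup>L \<mu> g)" for n \<omega>
  define W where "W n \<omega> = - (sqrt (real n) * gap p n \<omega> / (1 - p))" for n \<omega>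
  have [measurable]: "U n \<in> borel_measurable M" "W n \<in> borel_measurable M" for n
    unfolding U_def W_def by measurable
  have T_eq: "?T n \<omega> = U n \<omega> + W n \<omega>" for n \<omega>
  proof (cases "n = 0")
    case False
    then have n: "1 \<le> n" by simp
    have "sample_mean g n \<omega> = sample_mean (\<lambda>x. max (x - \<mu>.I p) 0) n \<omega> / (1 - p)"
      by (simp add: sample_mean_def g_def sum_divide_distrib[symmetric] mult.commute)
    moreover have "integral\<^sup>L \<mu> g = (\<integral>x. max (x - \<mu>.I p) 0 \<partial>\<mu>) / (1 - p)"
      by (simp add: g_def[abs_def])
    ultimately show ?thesis
      unfolding TVaR_diff_eq[OF p n int] U_def W_def
      by (simp add: diff_divide_distrib right_diff_distrib)
  qed (simp add: U_def W_def)
  have W: "(\<lambda>n. prob {\<omega> \<in> space M. \<delta> < \<bar>W n \<omega>\<bar>}) \<longlonglongrightarrow> 0" if \<delta>: "0 < \<delta>" for \<delta>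
  proof (rule tendstoI)
    fix e :: real assume e: "0 < e"
    \<comment> \<open>With the threshold \<open>\<delta> * (1 - p) / sqrt n\<close> for the gap, the
      window term becomes \<open>2 * K / (\<delta> * (1 - p))\<close>, which this choice makes
      \<open>e / 4\<close> for every \<open>n \<ge> 1\<close>.\<close>
    define K where "K = e * (\<delta> * (1 - p)) / 8"
    have K: "0 < K" using e \<delta> p by (simp add: K_def)
    have lower: "\<mu>.C (\<mu>.I p - K) < p"
      using \<mu>.pseudoinverse[OF p, of "\<mu>.I p - K"] K by (simp add: not_le[symmetric])
    have upper: "p < \<mu>.C (\<mu>.I p + K)"
      by (rule \<mu>.cdf_gt_of_isCont_quantile[OF p cont]) (use K in simp)
    define B where "B = 1 / (p - \<mu>.C (\<mu>.I p - K)) + 1 / (\<mu>.C (\<mu>.I p + K) - p)"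
    have bound: "prob {\<omega> \<in> space M. \<delta> < \<bar>W n \<omega>\<bar>} \<le> B / sqrt n + e / 4" if n: "1 \<le> n" for n
    proof -
      define \<epsilon> where "\<epsilon> = \<delta> * (1 - p) / sqrt n"
      have \<epsilon>: "0 < \<epsilon>" using \<delta> p n by (simp add: \<epsilon>_def)
      have "\<delta> < \<bar>W n \<omega>\<bar> \<longleftrightarrow> \<epsilon> < \<bar>gap p n \<omega>\<bar>" for \<omega>
        using p n by (simp add: W_def \<epsilon>_def abs_mult abs_divide field_simps)
      then have "prob {\<omega> \<in> space M. \<delta> < \<bar>W n \<omega>\<bar>} \<le> B / sqrt n + 2 * K / (\<epsilon> * sqrt n)"
        using prob_gap_le[OF n p less_imp_le[OF K] \<epsilon> lower upper] by (simp add: B_def)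
      also have "\<epsilon> * sqrt n = \<delta> * (1 - p)"
        using n by (simp add: \<epsilon>_def)
      also have "2 * K / (\<delta> * (1 - p)) = e / 4"
      proof -
        have "2 * (e * d / 8) / d = e / 4" if "d \<noteq> 0" for d :: real
          using that by simp
        from this[of "\<delta> * (1 - p)"] show ?thesis
          using \<delta> p by (simp only: K_def) simp
      qed
      finally show ?thesis .
    qed
    have "(\<lambda>n. B / sqrt (real n)) \<longlonglongrightarrow> 0"
      by real_asymp
    then have "\<forall>\<^sub>F n in sequentially. B / sqrt (real n) < e / 2"
      using e by (intro order_tendstoD(2)) auto
    then show "\<forall>\<^sub>F n in sequentially. dist (prob {\<omega> \<in> space M. \<delta> < \<bar>W n \<omega>\<bar>}) 0 < e"
      using eventually_ge_at_top[of 1]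
    proof eventually_elim
      case (elim n)
      then show ?case using bound[of n] e by simp
    qed
  qed
  show ?thesis
    unfolding conv_in_distr_def v_eq
  proof
    show "\<forall>n. ?T n \<in> borel_measurable M"
      by measurable
    show "weak_conv_m (\<lambda>n. distr M borel (?T n)) (normal_distr 0 v)"
    proof (rule levy_continuity)
      show "real_distribution (distr M borel (?T n))" for n
        by (rule real_distribution_distr) measurable
      show "real_distribution (normal_distr 0 v)"
        by (rule char_normal_distr(2)[OF v0])
      fix t
      have "(\<lambda>n. char (distr M borel (U n)) t) \<longlonglongrightarrow> complex_of_real (exp (- (v * t\<^sup>2) / 2))"
        unfolding U_def v_def by (rule clt_char[OF _ g2]) simp
      then show "(\<lambda>n. char (distr M borel (?T n)) t) \<longlonglongrightarrow> char (normal_distr 0 v) t"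
        unfolding char_normal_distr(1)[OF v0] T_eq by (intro char_distr_slutsky W) auto
    qed
  qed
qed

end

section \<open>From the cdf hypotheses to the common law\<close>

theorem mainTheorem13:
  fixes M :: "'a measure" and X :: "nat \<Rightarrow> 'a \<Rightarrow> real" and F :: "real \<Rightarrow> real" and p :: real
  assumes "prob_space M"
    and "prob_space.indep_vars M (\<lambda>_. borel) X {1..}"
    and "\<And>i. i \<ge> 1 \<Longrightarrow> cdf (distr M borel (X i)) = F"
    and "0 < p" and "p < 1"
  shows "(F \<in> cdfs_plus 1 \<longrightarrow>
           conv_in_prob M (\<lambda>n \<omega>. TVaR (empirical_cdf X n \<omega>) p) (\<lambda>_. TVaR F p)) \<and>
         (F \<in> cdfs_plus 2 \<and> isCont (quantile F) p \<longrightarrow>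
           conv_in_distr M (\<lambda>n \<omega>. sqrt (real n) * (TVaR (empirical_cdf X n \<omega>) p - TVaR F p))
             (normal_distr 0 (TVaR_variance F p)))"
proof -
  define \<mu> where "\<mu> = distr M borel (X 1)"
  interpret prob_space M by fact
  have rv: "X i \<in> borel_measurable M" if "1 \<le> i" for i
    using assms(2) that by (auto simp: indep_vars_def2)
  interpret iid_sample M X \<mu>
  proof
    show "indep_vars (\<lambda>_. borel) X {1..}" by fact
    show "distr M borel (X i) = \<mu>" if "1 \<le> i" for i
      unfolding \<mu>_def using that rv assms(3) by (intro cdf_unique) auto
  qed
  have F: "F = \<mu>.C"
    using assms(3)[of 1] by (simp add: \<mu>_def)
  \<comment> \<open>Membership supplies some law with cdf \<open>F\<close> and the required moment;
    a law is determined by its cdf, so that law is \<mu>.\<close>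
  have int: "integrable \<mu> (\<lambda>x. (max x 0) ^ k)" if k: "F \<in> cdfs_plus k" for k
  proof -
    obtain \<nu> where \<nu>: "F = cdf \<nu>" "real_distribution \<nu>" "integrable \<nu> (\<lambda>x. (max x 0) ^ k)"
      using k by (auto simp: cdfs_plus_def)
    then have "\<nu> = \<mu>"
      using F \<mu>.real_distribution_axioms by (intro cdf_unique) auto
    then show ?thesis using \<nu> by simp
  qed
  have "conv_in_prob M (\<lambda>n \<omega>. TVaR (empirical_cdf X n \<omega>) p) (\<lambda>_. TVaR F p)"
    if "F \<in> cdfs_plus 1"
    unfolding F using int[OF that] \<mu>.integrable_positive_part_shift[of 0]
    by (intro TVaR_consistent assms(4,5)) auto
  moreover have "conv_in_distr M (\<lambda>n \<omega>. sqrt (real n) * (TVaR (empirical_cdf X n \<omega>) p - TVaR F p))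
      (normal_distr 0 (TVaR_variance F p))" if "F \<in> cdfs_plus 2" "isCont (quantile F) p"
  proof -
    have "integrable \<mu> (\<lambda>x. (max (x - \<mu>.I p) 0)\<^sup>2)"
    proof (rule Bochner_Integration.integrable_bound)
      show "integrable \<mu> (\<lambda>x. 2 * (max x 0)\<^sup>2 + 2 * (\<mu>.I p)\<^sup>2)"
        using int[OF that(1)] by simp
      \<comment> \<open>Shifting the positive part costs at most \<open>\<bar>a\<bar>\<close>; the
        square of a sum is at most twice the sum of the squares.\<close>
      have "(max (x - a) 0)\<^sup>2 \<le> 2 * (max x 0)\<^sup>2 + 2 * a\<^sup>2" for x a :: real
      proof -
        have "max (x - a) 0 \<le> max x 0 + \<bar>a\<bar>" by auto
        then have "(max (x - a) 0)\<^sup>2 \<le> (max x 0 + \<bar>a\<bar>)\<^sup>2"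
          by (intro power_mono) auto
        also have "\<dots> \<le> 2 * (max x 0)\<^sup>2 + 2 * \<bar>a\<bar>\<^sup>2"
          using zero_le_power2[of "max x 0 - \<bar>a\<bar>"] unfolding power2_sum power2_diff by linarith
        finally show ?thesis by simp
      qed
      then show "AE x in \<mu>. norm ((max (x - \<mu>.I p) 0)\<^sup>2) \<le> norm (2 * (max x 0)\<^sup>2 + 2 * (\<mu>.I p)\<^sup>2)"
        by (intro AE_I2) simp
    qed simp
    then show ?thesis
      using that(2) unfolding F by (intro TVaR_asymptotically_normal assms(4,5)) auto
  qed
  ultimately show ?thesis by blast
qed

end
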